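(* Let $f_1,f_2$ be holomorphic maps from open neighborhoods of $0\in\mathbb{C}$ to $\mathbb{C}$, with $f_i(z)=z+a_iz^2+o(z^2)$, $a_i\neq0$. Let $\mathbf{h}_i$ be the (non-lifted) horn map of $f_i$, let $\mathcal{D}_i^{+}$ (resp. $\mathcal{D}_i^{-}$) be the connected component of its domain containing a punctured neighborhood of $+i\infty$ (resp. $-i\infty$), and let $\mathbf{h}_i^\pm$ be the restriction of $\mathbf{h}_i$ to $\mathcal{D}_i^\pm$. Let $\sigma\in\mathbb{C}/\mathbb{Z}$ and let the sign $\pm$ be fixed. Then any holomorphic map $\psi^\pm:\mathcal{D}_1^\pm\to\mathcal{D}_2^\pm$ such that $\mathbf{h}_1^\pm=T_\sigma^{-1}\circ\mathbf{h}_2^\pm\circ\psi^\pm$ extends holomorphically to a map fixing $\pm i\infty$, and $$\psi^\pm(w)=w+\rho^\pm+o(1)\quad\text{as } w\to\pm i\infty$$ for some $\rho^\pm\in\mathbb{C}$ (the equality being understood modulo $\mathbb{Z}$).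
   Context: Let $f:\mathrm{Dom}(f)\to\mathbb{C}$ be holomorphic on an open neighborhood of $0$ in $\mathbb{C}$ with $f(z)=z+az^2+o(z^2)$, $a\ne0$. $T_s$ denotes the translation $w\mapsto w+s$ (on $\mathbb{C}$ or on $\mathbb{C}/\mathbb{Z}$). For a map $g$ and a set $X$, $g(X)$ means $g(X\cap\mathrm{Dom}(g))$. The basin $B_f$ is the (open) set of $z$ such that $f^n(z)$ is defined for all $n$ and tends to $0$ without ever being equal to $0$. Petals: an attracting petal of $f$ is an open set $P_A\subset\mathbb{C}^*$ that is connected and simply connected, with $f$ defined on $P_A$, $f(P_A)\subset P_A$, $f^n(z)\to0$ for all $z\in P_A$, and such that whenever $f^n(z)\to 0$, either the orbit is eventually equal to $0$ or $f^n(z)\in P_A$ for some $n$. A Fatou coordinate on it is an injective holomorphic $\Phi_A:P_A\to\mathbb{C}$ with $\Phi_A\circ f=T_1\circ\Phi_A$. A repelling petal $P_R$ is an attracting petal of a local inverse of $f$ fixing $0$; its Fatou coordinate $\Phi_R$ is minus an attracting Fatou coordinate of that local inverse (so it conjugates $f$ to $T_1$). Extensions: $\Phi_A^{\mathrm{ext}}:B_f\to\mathbb{C}$ is $\Phi_A^{\mathrm{ext}}(z)=\Phi_A(f^n(z))-n$ for any $n$ with $f^n(z)\in P_A$. $\Psi_R^{\mathrm{ext}}$ is the map defined as follows: for $w\in\mathbb{C}$, choose $n\in\mathbb{N}$ with $w-n\in\Phi_R(P_R)$; if $f^n(\Phi_R^{-1}(w-n))$ is defined, this is $\Psi_R^{\mathrm{ext}}(w)$;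 otherwise $w\notin\mathrm{Dom}(\Psi_R^{\mathrm{ext}})$. Up to post- (resp. pre-) composition with a translation, these are independent of all choices; a choice is fixed for each map considered. Horn maps: the lifted horn map is $h=\Phi_A^{\mathrm{ext}}\circ\Psi_R^{\mathrm{ext}}$ with domain $\widetilde{\mathcal{D}}=(\Psi_R^{\mathrm{ext}})^{-1}(B_f)$, which is invariant under $T_1$; $h$ commutes with $T_1$. With $\pi:\mathbb{C}\to\mathbb{C}/\mathbb{Z}$ the projection, the (non-lifted) horn map is the quotient $\mathbf{h}:\mathcal{D}=\pi(\widetilde{\mathcal{D}})\to\mathbb{C}/\mathbb{Z}$. $\mathcal{D}$ contains punctured neighborhoods of both ends $\pm i\infty$ of $\mathbb{C}/\mathbb{Z}$, where $\mathbb{C}/\mathbb{Z}\cup\{\pm i\infty\}$ is identified with the Riemann sphere via $w\mapsto e^{2\pi i w}$. Quantities attached to $f_i$ carry the index $i$. *)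

theory Defs
  imports "HOL-Complex_Analysis.Complex_Analysis" "HOL-Library.Landau_Symbols"
begin

section \<open>Parabolic maps, petals and Fatou coordinates\<close>

text \<open>
  A partially defined map with open domain is given by its domain \<open>U\<close> and a total function \<open>f\<close>
  whose values outside \<open>U\<close> are irrelevant.
\<close>

text \<open>The filter \<open>nhds 0\<close> contains the point \<open>0\<close> itself, so the expansion includes \<open>f 0 = 0\<close>.\<close>

definition parabolic_map :: "complex set \<Rightarrow> (complex \<Rightarrow> complex) \<Rightarrow> complex \<Rightarrow> bool" where
  "parabolic_map U f a \<longleftrightarrow>
     open U \<and> 0 \<in> U \<and> f holomorphic_on U \<and> a \<noteq> 0 \<and>
     (\<lambda>z. f z - (z + a * z^2)) \<in> o[nhds 0](\<lambda>z. z^2)"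

definition iterate_defined :: "complex set \<Rightarrow> (complex \<Rightarrow> complex) \<Rightarrow> nat \<Rightarrow> complex \<Rightarrow> bool" where
  "iterate_defined U f n z \<longleftrightarrow> (\<forall>k<n. (f ^^ k) z \<in> U)"

definition basin :: "complex set \<Rightarrow> (complex \<Rightarrow> complex) \<Rightarrow> complex set" where
  "basin U f =
     {z. (\<forall>n. iterate_defined U f n z) \<and> (\<lambda>n. (f ^^ n) z) \<longlonglongrightarrow> 0 \<and> (\<forall>n. (f ^^ n) z \<noteq> 0)}"

definition attracting_petal ::
  "complex set \<Rightarrow> (complex \<Rightarrow> complex) \<Rightarrow> complex set \<Rightarrow> bool" where
  "attracting_petal U f P \<longleftrightarrow>
     open P \<and> 0 \<notin> P \<and> connected P \<and> simply_connected P \<and> P \<subseteq> U \<and> f ` P \<subseteq> P \<and>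
     (\<forall>z\<in>P. (\<lambda>n. (f ^^ n) z) \<longlonglongrightarrow> 0) \<and>
     (\<forall>z. (\<forall>n. iterate_defined U f n z) \<and> (\<lambda>n. (f ^^ n) z) \<longlonglongrightarrow> 0 \<longrightarrow>
        (\<forall>\<^sub>F n in sequentially. (f ^^ n) z = 0) \<or> (\<exists>n. (f ^^ n) z \<in> P))"

definition fatou_coordinate ::
  "(complex \<Rightarrow> complex) \<Rightarrow> complex set \<Rightarrow> (complex \<Rightarrow> complex) \<Rightarrow> bool" where
  "fatou_coordinate f P \<Phi> \<longleftrightarrow>
     \<Phi> holomorphic_on P \<and> inj_on \<Phi> P \<and> (\<forall>z\<in>P. \<Phi> (f z) = \<Phi> z + 1)"

text \<open>
  The conditions force \<open>g\<close> to be injective on \<open>V\<close>, hence \<open>g ` V\<close> is an open neighbourhood of \<open>0\<close>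
  and \<open>f\<close> restricts to a bijection from \<open>g ` V\<close> onto \<open>V\<close> with inverse \<open>g\<close>.
\<close>

definition local_inverse ::
  "complex set \<Rightarrow> (complex \<Rightarrow> complex) \<Rightarrow> complex set \<Rightarrow> (complex \<Rightarrow> complex) \<Rightarrow> bool" where
  "local_inverse U f V g \<longleftrightarrow>
     open V \<and> 0 \<in> V \<and> g holomorphic_on V \<and> g 0 = 0 \<and> g ` V \<subseteq> U \<and> (\<forall>z\<in>V. f (g z) = z)"

definition attracting_petal_coordinate ::
  "complex set \<Rightarrow> (complex \<Rightarrow> complex) \<Rightarrow> complex set \<Rightarrow> (complex \<Rightarrow> complex) \<Rightarrow> bool" where
  "attracting_petal_coordinate U f P \<Phi> \<longleftrightarrow> attracting_petal U f P \<and> fatou_coordinate f P \<Phi>"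

definition repelling_petal_coordinate ::
  "complex set \<Rightarrow> (complex \<Rightarrow> complex) \<Rightarrow> complex set \<Rightarrow> (complex \<Rightarrow> complex) \<Rightarrow> bool" where
  "repelling_petal_coordinate U f P \<Phi> \<longleftrightarrow>
     (\<exists>V g. local_inverse U f V g \<and> attracting_petal_coordinate V g P (\<lambda>z. - \<Phi> z))"

section \<open>Extended Fatou coordinates and the lifted horn map\<close>

text \<open>
  The choices of \<open>n\<close> made below do not influence the values, because \<open>f\<close> maps an attracting petal
  into itself and a local inverse of \<open>f\<close> maps a repelling petal into itself.
\<close>

definition Phi_ext ::
  "(complex \<Rightarrow> complex) \<Rightarrow> complex set \<Rightarrow> (complex \<Rightarrow> complex) \<Rightarrow> complex \<Rightarrow> complex" where
  "Phi_ext f PA \<Phi>A z =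
     (let n = (SOME n. (f ^^ n) z \<in> PA) in \<Phi>A ((f ^^ n) z) - of_nat n)"

definition Psi_shift :: "complex set \<Rightarrow> (complex \<Rightarrow> complex) \<Rightarrow> complex \<Rightarrow> nat" where
  "Psi_shift PR \<Phi>R w = (SOME n. w - of_nat n \<in> \<Phi>R ` PR)"

definition Psi_ext_dom ::
  "complex set \<Rightarrow> (complex \<Rightarrow> complex) \<Rightarrow> complex set \<Rightarrow> (complex \<Rightarrow> complex) \<Rightarrow> complex set" where
  "Psi_ext_dom U f PR \<Phi>R =
     {w. (\<exists>n::nat. w - of_nat n \<in> \<Phi>R ` PR) \<and>
         (let n = Psi_shift PR \<Phi>R w in
            iterate_defined U f n (inv_into PR \<Phi>R (w - of_nat n)))}"

definition Psi_ext ::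
  "(complex \<Rightarrow> complex) \<Rightarrow> complex set \<Rightarrow> (complex \<Rightarrow> complex) \<Rightarrow> complex \<Rightarrow> complex" where
  "Psi_ext f PR \<Phi>R w =
     (let n = Psi_shift PR \<Phi>R w in (f ^^ n) (inv_into PR \<Phi>R (w - of_nat n)))"

definition lifted_horn_dom ::
  "complex set \<Rightarrow> (complex \<Rightarrow> complex) \<Rightarrow> complex set \<Rightarrow> (complex \<Rightarrow> complex) \<Rightarrow> complex set" where
  "lifted_horn_dom U f PR \<Phi>R =
     {w \<in> Psi_ext_dom U f PR \<Phi>R. Psi_ext f PR \<Phi>R w \<in> basin U f}"

definition lifted_horn ::
  "(complex \<Rightarrow> complex) \<Rightarrow> complex set \<Rightarrow> (complex \<Rightarrow> complex) \<Rightarrow>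
     complex set \<Rightarrow> (complex \<Rightarrow> complex) \<Rightarrow> complex \<Rightarrow> complex" where
  "lifted_horn f PA \<Phi>A PR \<Phi>R w = Phi_ext f PA \<Phi>A (Psi_ext f PR \<Phi>R w)"

section \<open>The cylinder \<open>\<complex>/\<int>\<close>\<close>

quotient_type cylinder = complex / "\<lambda>z w. z - w \<in> \<int>"
proof (rule equivpI)
  show "reflp (\<lambda>z w::complex. z - w \<in> \<int>)"
    by (simp add: reflp_def)
  show "symp (\<lambda>z w::complex. z - w \<in> \<int>)"
    by (metis (mono_tags, lifting) Ints_minus minus_diff_eq sympI)
  show "transp (\<lambda>z w::complex. z - w \<in> \<int>)"
    by (rule transpI) (metis Ints_add diff_add_cancel add_diff_eq)
qed

lift_definition to_cylinder :: "complex \<Rightarrow> cylinder" is "\<lambda>z. z" .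

instantiation cylinder :: ab_group_add
begin

lift_definition zero_cylinder :: cylinder is 0 .

lift_definition plus_cylinder :: "cylinder \<Rightarrow> cylinder \<Rightarrow> cylinder" is "(+)"
  by (metis Ints_add add_diff_add)

lift_definition uminus_cylinder :: "cylinder \<Rightarrow> cylinder" is uminus
  by (metis Ints_minus minus_diff_minus)

lift_definition minus_cylinder :: "cylinder \<Rightarrow> cylinder \<Rightarrow> cylinder" is "(-)"
  by (metis (no_types, lifting) Ints_diff diff_diff_eq2 diff_diff_eq add_diff_eq diff_add_eq add.commute)

instance
  by standard (transfer; simp add: algebra_simps)+

end

instantiation cylinder :: topological_space
begin

definition open_cylinder :: "cylinder set \<Rightarrow> bool" where
  "open_cylinder S \<longleftrightarrow> open (to_cylinder -` S)"

instance
proof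
  show "open (UNIV :: cylinder set)"
    by (simp add: open_cylinder_def)
  show "open (S \<inter> T)" if "open S" "open T" for S T :: "cylinder set"
    using that by (simp add: open_cylinder_def open_Int)
  show "open (\<Union>K)" if "\<forall>S\<in>K. open S" for K :: "cylinder set set"
    using that by (simp add: open_cylinder_def vimage_Union open_UN)
qed

end

text \<open>
  The projection is a local biholomorphism, so for an open set \<open>D\<close> a map into the cylinder is
  holomorphic on \<open>D\<close> iff near every point it lifts to a holomorphic function on the plane.
\<close>

definition cylinder_holomorphic_on ::
  "(cylinder \<Rightarrow> cylinder) \<Rightarrow> cylinder set \<Rightarrow> bool" where
  "cylinder_holomorphic_on \<psi> D \<longleftrightarrow>
     (\<forall>w. to_cylinder w \<in> D \<longrightarrow>
        (\<exists>W G. open W \<and> w \<in> W \<and> G holomorphic_on W \<and>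
           (\<forall>v\<in>W. to_cylinder v \<in> D \<longrightarrow> \<psi> (to_cylinder v) = to_cylinder (G v))))"

text \<open>
  The end \<open>+\<i>\<infinity>\<close> corresponds to \<open>s = 1\<close> and the end \<open>-\<i>\<infinity>\<close> to \<open>s = -1\<close>. The filter
  \<open>cylinder_end s\<close> is generated by the punctured neighbourhoods of that end.
\<close>

definition cylinder_end :: "int \<Rightarrow> cylinder filter" where
  "cylinder_end s = filtermap to_cylinder (filtercomap (\<lambda>w. of_int s * Im w) at_top)"

text \<open>
  Under the identification of the cylinder with its two ends with the Riemann sphere by
  \<open>w \<mapsto> exp (2 \<pi> \<i> w)\<close>, the end \<open>+\<i>\<infinity>\<close> is \<open>0\<close> and \<open>-\<i>\<infinity>\<close> is \<open>\<infinity>\<close>. For \<open>s = 1\<close> the function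
  \<open>end_coord s\<close> is this identification; for \<open>s = -1\<close> it is its reciprocal, that is, the identification
  read in the chart of the sphere at \<open>\<infinity>\<close>. In both cases the end is the point \<open>0\<close> of the chart.
\<close>

lift_definition end_coord :: "int \<Rightarrow> cylinder \<Rightarrow> complex" is
  "\<lambda>s w. exp (2 * of_real pi * \<i> * of_int s * w)"
proof -
  fix s :: int and z w :: complex
  assume "z - w \<in> \<int>"
  then obtain n where "z = w + of_int n"
    by (metis Ints_cases add.commute diff_add_cancel)
  then have "2 * of_real pi * \<i> * of_int s * z =
      2 * of_real pi * \<i> * of_int s * w + of_real (of_int (2 * (s * n)) * pi) * \<i>"
    by (simp add: algebra_simps)
  then show "exp (2 * of_real pi * \<i> * of_int s * z) = exp (2 * of_real pi * \<i> * of_int s * w)"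
    unfolding exp_eq by blast
qed

definition extends_fixing_end :: "int \<Rightarrow> (cylinder \<Rightarrow> cylinder) \<Rightarrow> cylinder set \<Rightarrow> bool" where
  "extends_fixing_end s \<psi> D \<longleftrightarrow>
     (\<exists>F. F holomorphic_on insert 0 (end_coord s ` D) \<and> F 0 = 0 \<and>
        (\<forall>x\<in>D. F (end_coord s x) = end_coord s (\<psi> x)))"

section \<open>The horn map\<close>

definition horn_dom ::
  "complex set \<Rightarrow> (complex \<Rightarrow> complex) \<Rightarrow> complex set \<Rightarrow> (complex \<Rightarrow> complex) \<Rightarrow> cylinder set" where
  "horn_dom U f PR \<Phi>R = to_cylinder ` lifted_horn_dom U f PR \<Phi>R"

text \<open>
  The value does not depend on the chosen representative, since the lifted horn map commutes with
  the translation by \<open>1\<close>.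
\<close>

definition horn ::
  "complex set \<Rightarrow> (complex \<Rightarrow> complex) \<Rightarrow> complex set \<Rightarrow> (complex \<Rightarrow> complex) \<Rightarrow>
     complex set \<Rightarrow> (complex \<Rightarrow> complex) \<Rightarrow> cylinder \<Rightarrow> cylinder" where
  "horn U f PA \<Phi>A PR \<Phi>R x =
     to_cylinder (lifted_horn f PA \<Phi>A PR \<Phi>R
       (SOME w. w \<in> lifted_horn_dom U f PR \<Phi>R \<and> to_cylinder w = x))"

text \<open>At most one component satisfies this, as any two punctured neighbourhoods of an end meet.\<close>

definition end_component :: "int \<Rightarrow> cylinder set \<Rightarrow> cylinder set \<Rightarrow> bool" where
  "end_component s D C \<longleftrightarrow> C \<in> components D \<and> (\<forall>\<^sub>F x in cylinder_end s. x \<in> C)"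

end

theory Submission
  imports Defs
begin

text \<open>
  In the coordinate \<open>u = -1/(a z)\<close> a parabolic map is \<open>u \<mapsto> u + 1 + o(1)\<close> near infinity. An orbit
  whose repelling Fatou coordinate has large imaginary part therefore passes far above or below the
  origin of the \<open>u\<close>-plane: it stays in a small disc around \<open>0\<close>, where the map is injective, for
  all positive and negative times. Hence the horn map is injective near the two ends of the
  cylinder, and by Picard's theorem it has no essential singularity there. In the coordinate
  \<open>z = exp (2 \<pi> \<i> w)\<close> it has the form \<open>H z = z exp (G z)\<close> with a single-valued \<open>G\<close>, because the
  lifted horn map commutes with the translation by \<open>1\<close>. A single-valued \<open>G\<close> cannot have real part
  tending to \<open>\<plusminus>\<infinity>\<close> at an isolated singularity, so \<open>H z \<sim> c z\<close> with \<open>c \<noteq> 0\<close>.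

  Let \<open>F\<close> be \<open>\<psi>\<close> in these coordinates, so that \<open>H\<^sub>1 = \<kappa> H\<^sub>2 \<circ> F\<close> and \<open>H\<^sub>2 \<circ> F \<rightarrow> 0\<close> at \<open>0\<close>. By
  Casorati--Weierstrass \<open>F\<close> has a limit \<open>l\<close> on the sphere. If \<open>l\<close> is finite and nonzero, the open
  mapping theorem makes it a puncture of the domain of \<open>H\<^sub>2\<close> at which \<open>H\<^sub>2 \<rightarrow> 0\<close>, which is again
  impossible because \<open>H\<^sub>2\<close> has a single-valued logarithm there. If \<open>l = \<infinity>\<close>, the domain of \<open>H\<^sub>2\<close>
  contains a neighbourhood of the opposite end, where \<open>H\<^sub>2 \<rightarrow> \<infinity>\<close>. So \<open>l = 0\<close>, and
  \<open>F z / z \<rightarrow> c\<^sub>1 / (\<kappa> c\<^sub>2)\<close>.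
\<close>

section \<open>Isolated singularities\<close>

text \<open>Applied to functions extended across a removable singularity, or across a pole after
  inversion. Avoiding the central value elsewhere rules out constancy, so the open mapping theorem
  gives a full disc of values.\<close>

lemma open_image_punctured_nhd:
  assumes "r > 0" "F holomorphic_on ball z r"
    and "\<And>w. w \<in> ball z r - {z} \<Longrightarrow> F w \<noteq> F z"
  obtains e where "e > 0" "ball (F z) e \<subseteq> F ` ball z r"
proof -
  have "z + of_real (r/2) \<in> ball z r - {z}"
    using \<open>r > 0\<close> by (auto simp: dist_norm)
  then have "\<not> F constant_on ball z r"
    using assms(3) \<open>r > 0\<close> unfolding constant_on_def
    by (metis Diff_iff centre_in_ball)
  then have "open (F ` ball z r)"
    using open_mapping_thm[OF assms(2), of "ball z r"] by auto
  moreover have "F z \<in> F ` ball z r"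
    using \<open>r > 0\<close> by auto
  ultimately show thesis
    using that by (meson openE)
qed

text \<open>A real part tending to minus infinity forces a pole, so \<open>1/G\<close> extends by 0
  to an open map. It then takes small positive real values, and there \<open>G\<close> itself would
  be positive.\<close>

lemma Re_not_at_bot_at_singularity:
  assumes "r > 0" "G holomorphic_on ball z r - {z}"
  shows "\<not> filterlim (\<lambda>w. Re (G w)) at_bot (at z)"
proof
  assume lim: "filterlim (\<lambda>w. Re (G w)) at_bot (at z)"
  then have "eventually (\<lambda>w. Re (G w) < 0) (at z)"
    by (simp add: filterlim_at_bot_dense)
  then obtain d where d: "d > 0" "\<And>w. w \<noteq> z \<Longrightarrow> dist w z < d \<Longrightarrow> Re (G w) < 0"
    by (auto simp: eventually_at)
  define \<rho> where "\<rho> = min d r"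
  have \<rho>: "\<rho> > 0" "\<rho> \<le> r" using d assms(1) by (auto simp: \<rho>_def)
  have neg: "Re (G w) < 0" if "w \<in> ball z \<rho> - {z}" for w
    using that d(2)[of w] by (auto simp: \<rho>_def dist_commute)
  have "filterlim (\<lambda>w. - Re (G w)) at_top (at z)"
    using lim by (simp add: filterlim_uminus_at_bot)
  then have "filterlim (\<lambda>w. norm (G w)) at_top (at z)"
    by (rule filterlim_at_top_mono)
      (auto intro!: always_eventually simp: abs_Re_le_cmod order_trans[OF abs_ge_minus_self])
  then have "filterlim G at_infinity (at z)"
    using filterlim_at_infinity_conv_norm_at_top by blast
  then have lim0: "((\<lambda>w. inverse (G w)) \<longlongrightarrow> 0) (at z)"
    using tendsto_inverse_0 filterlim_compose by blast
  define K where "K = (\<lambda>w. if w = z then 0 else inverse (G w))"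
  have "(\<lambda>w. inverse (G w)) holomorphic_on ball z \<rho> - {z}"
  proof (intro holomorphic_intros)
    show "G holomorphic_on ball z \<rho> - {z}"
      using assms(2) \<rho> by (meson Diff_mono holomorphic_on_subset order_refl subset_ball)
    show "G w \<noteq> 0" if "w \<in> ball z \<rho> - {z}" for w
      using neg[OF that] by auto
  qed
  then have "K holomorphic_on ball z \<rho>"
    unfolding K_def using lim0 by (intro removable_singularity) auto
  moreover have "K w \<noteq> K z" if "w \<in> ball z \<rho> - {z}" for w
    using neg[OF that] that by (auto simp: K_def)
  ultimately obtain e where e: "e > 0" "ball (K z) e \<subseteq> K ` ball z \<rho>"
    using open_image_punctured_nhd[OF \<rho>(1)] by metis
  have "complex_of_real (e/2) \<in> ball (K z) e"
    using e(1) by (auto simp: K_def dist_norm)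
  then obtain w where w: "w \<in> ball z \<rho>" "K w = of_real (e/2)"
    using e(2) by (metis imageE subsetD)
  then have "w \<noteq> z" using e(1) by (auto simp: K_def)
  then have "inverse (G w) = of_real (e/2)"
    using w(2) by (simp add: K_def)
  then have "G w = of_real (2/e)"
    by (metis inverse_divide inverse_inverse_eq of_real_inverse)
  then have "Re (G w) > 0" using e(1) by simp
  with neg[of w] w \<open>w \<noteq> z\<close> show False by simp
qed

section \<open>Iteration and extended Fatou coordinates\<close>

lemma iterate_defined_add:
  "iterate_defined U f (m + n) z \<longleftrightarrow>
     iterate_defined U f m z \<and> iterate_defined U f n ((f ^^ m) z)"
proof
  assume A: "iterate_defined U f (m + n) z"
  have "(f ^^ k) ((f ^^ m) z) \<in> U" if "k < n" for k
    using A that unfolding iterate_defined_def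
    by (metis add.commute add_less_cancel_right funpow_add o_apply)
  with A show "iterate_defined U f m z \<and> iterate_defined U f n ((f ^^ m) z)"
    by (auto simp: iterate_defined_def)
next
  assume A: "iterate_defined U f m z \<and> iterate_defined U f n ((f ^^ m) z)"
  show "iterate_defined U f (m + n) z"
    unfolding iterate_defined_def
  proof (intro allI impI)
    fix k assume k: "k < m + n"
    show "(f ^^ k) z \<in> U"
    proof (cases "k < m")
      case True
      then show ?thesis using A by (auto simp: iterate_defined_def)
    next
      case False
      then have "k = (k - m) + m" by simp
      then have "(f ^^ k) z = (f ^^ (k - m)) ((f ^^ m) z)"
        by (metis funpow_add o_apply)
      moreover have "k - m < n" using k False by auto
      ultimately show ?thesis using A by (auto simp: iterate_defined_def)
    qed
  qed
qed

lemma iterate_defined_0 [simp]: "iterate_defined U f 0 z"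
  by (simp add: iterate_defined_def)

lemma iterate_defined_Suc:
  "iterate_defined U f (Suc n) z \<longleftrightarrow> iterate_defined U f n z \<and> (f ^^ n) z \<in> U"
  by (auto simp: iterate_defined_def less_Suc_eq)

lemma iterate_defined_Suc':
  "iterate_defined U f (Suc n) z \<longleftrightarrow> z \<in> U \<and> iterate_defined U f n (f z)"
  using iterate_defined_add[of U f 1 n z] by (simp add: iterate_defined_Suc)

lemma
  assumes "open U" "f holomorphic_on U"
  shows open_iterate_defined: "open {z. iterate_defined U f n z}"
    and holomorphic_on_iterate: "(f ^^ n) holomorphic_on {z. iterate_defined U f n z}"
proof -
  have "open {z. iterate_defined U f n z} \<and> (f ^^ n) holomorphic_on {z. iterate_defined U f n z}"
  proof (induction n)
    case 0
    show ?case by (auto simp: iterate_defined_def intro: holomorphic_intros)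
  next
    case (Suc n)
    let ?D = "{z. iterate_defined U f n z}"
    have eq: "{z. iterate_defined U f (Suc n) z} = ?D \<inter> (f ^^ n) -` U"
      by (auto simp: iterate_defined_Suc)
    have "open (?D \<inter> (f ^^ n) -` U)"
      using Suc assms(1) by (intro continuous_open_preimage holomorphic_on_imp_continuous_on) auto
    moreover have "(f \<circ> (f ^^ n)) holomorphic_on (?D \<inter> (f ^^ n) -` U)"
      using Suc assms(2) by (intro holomorphic_on_compose_gen[of _ _ _ U])
        (auto intro: holomorphic_on_subset)
    ultimately show ?case unfolding eq funpow.simps by blast
  qed
  then show "open {z. iterate_defined U f n z}"
    "(f ^^ n) holomorphic_on {z. iterate_defined U f n z}" by auto
qed

text \<open>Used twice: for the map with its attracting petal, and for its local inverse with the
  repelling petal and the coordinate \<open>- \<Phi>R\<close>.\<close>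

locale petal_map =
  fixes U :: "complex set" and f :: "complex \<Rightarrow> complex"
    and P :: "complex set" and \<Phi> :: "complex \<Rightarrow> complex"
  assumes open_U: "open U" and hol_f: "f holomorphic_on U" and f_0 [simp]: "f 0 = 0"
    and petal: "attracting_petal_coordinate U f P \<Phi>"
begin

lemma open_P: "open P" and P_0: "0 \<notin> P" and P_sub: "P \<subseteq> U" and P_inv: "z \<in> P \<Longrightarrow> f z \<in> P"
  and P_lim: "z \<in> P \<Longrightarrow> (\<lambda>n. (f ^^ n) z) \<longlonglongrightarrow> 0"
  and \<Phi>_hol: "\<Phi> holomorphic_on P" and \<Phi>_inj: "inj_on \<Phi> P"
  and \<Phi>_f: "z \<in> P \<Longrightarrow> \<Phi> (f z) = \<Phi> z + 1"
  using petal
  by (auto simp: attracting_petal_coordinate_def attracting_petal_def fatou_coordinate_def)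

lemma funpow_0 [simp]: "(f ^^ n) 0 = 0"
  by (induction n) auto

lemma funpow_P: "z \<in> P \<Longrightarrow> (f ^^ n) z \<in> P"
  by (induction n) (auto intro: P_inv)

lemma \<Phi>_funpow: "z \<in> P \<Longrightarrow> \<Phi> ((f ^^ n) z) = \<Phi> z + of_nat n"
  by (induction n) (auto simp: \<Phi>_f funpow_P)

lemma funpow_P_mono:
  assumes "(f ^^ n) z \<in> P" "n \<le> m"
  shows "(f ^^ m) z \<in> P"
proof -
  have "(f ^^ m) z = (f ^^ (m - n)) ((f ^^ n) z)"
    using assms(2) by (metis funpow_add le_add_diff_inverse2 o_apply)
  then show ?thesis using assms funpow_P by simp
qed

text \<open>Once the orbit is in \<open>P\<close>, each further step adds 1 both to
  \<open>\<Phi>\<close> and to the subtracted time, so the entry time picked by \<open>SOME\<close>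
  is immaterial.\<close>

lemma Phi_ext_eq:
  assumes "(f ^^ n) z \<in> P"
  shows "Phi_ext f P \<Phi> z = \<Phi> ((f ^^ n) z) - of_nat n"
proof -
  have mono: "\<Phi> ((f ^^ m) z) - of_nat m = \<Phi> ((f ^^ k) z) - of_nat k"
    if "(f ^^ k) z \<in> P" "k \<le> m" for k m
  proof -
    have "(f ^^ m) z = (f ^^ (m - k)) ((f ^^ k) z)"
      using that(2) by (metis funpow_add le_add_diff_inverse2 o_apply)
    then show ?thesis using \<Phi>_funpow[OF that(1), of "m - k"] that(2) by (simp add: of_nat_diff)
  qed
  define k where "k = (SOME n. (f ^^ n) z \<in> P)"
  have "(f ^^ k) z \<in> P"
    unfolding k_def using assms by (rule someI)
  then show ?thesis
    using mono[of n k] mono[of k n] assms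
    unfolding Phi_ext_def k_def[symmetric] Let_def by (metis nat_le_linear)
qed

text \<open>A basin orbit never vanishes, which leaves only entry into \<open>P\<close> among the
  alternatives in the definition of a petal. Conversely, \<open>P\<close> is invariant, lies in
  \<open>U\<close>, omits 0 and has convergent orbits, so one visit suffices.\<close>

lemma basin_iff:
  "z \<in> basin U f \<longleftrightarrow> (\<exists>n. iterate_defined U f n z \<and> (f ^^ n) z \<in> P)"
proof
  assume "z \<in> basin U f"
  moreover from this have "\<not> (\<forall>\<^sub>F n in sequentially. (f ^^ n) z = 0)"
    by (auto simp: basin_def eventually_sequentially)
  ultimately show "\<exists>n. iterate_defined U f n z \<and> (f ^^ n) z \<in> P"
    using petal by (auto simp: basin_def attracting_petal_coordinate_def attracting_petal_def)
next
  assume "\<exists>n. iterate_defined U f n z \<and> (f ^^ n) z \<in> P"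
  then obtain n where n: "iterate_defined U f n z" "(f ^^ n) z \<in> P" by auto
  have "iterate_defined U f m z" for m
  proof (cases "m \<le> n")
    case True
    then show ?thesis using n(1) by (auto simp: iterate_defined_def)
  next
    case False
    have "iterate_defined U f (m - n) ((f ^^ n) z)"
      using n(2) funpow_P P_sub unfolding iterate_defined_def by blast
    then show ?thesis
      using iterate_defined_add[of U f n "m - n" z] n(1) False by simp
  qed
  moreover have "(\<lambda>m. (f ^^ m) z) \<longlonglongrightarrow> 0"
  proof -
    have "(\<lambda>m. (f ^^ (m + n)) z) \<longlonglongrightarrow> 0"
      using P_lim[OF n(2)] by (simp add: funpow_add)
    then show ?thesis by (rule LIMSEQ_offset)
  qed
  moreover have "(f ^^ m) z \<noteq> 0" for m
  proof
    assume "(f ^^ m) z = 0"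
    then have "(f ^^ (n + m)) z = 0" by (simp add: funpow_add)
    then show False using funpow_P_mono[OF n(2), of "n + m"] P_0 by simp
  qed
  ultimately show "z \<in> basin U f" by (simp add: basin_def)
qed

lemma P_subset_basin: "P \<subseteq> basin U f"
  using basin_iff by (metis iterate_defined_0 funpow.simps(1) id_apply subsetI)

lemma basin_f: "z \<in> basin U f \<Longrightarrow> f z \<in> basin U f"
  using LIMSEQ_Suc[of "\<lambda>n. (f ^^ n) z" 0]
  unfolding basin_def mem_Collect_eq
  by (metis (no_types, lifting) ext funpow_Suc_right iterate_defined_Suc' o_apply)

lemma basin_sub: "basin U f \<subseteq> U"
  using iterate_defined_Suc[of U f 0] by (auto simp: basin_def)

lemma Phi_ext_P: "z \<in> P \<Longrightarrow> Phi_ext f P \<Phi> z = \<Phi> z"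
  using Phi_ext_eq[of 0 z] by simp

lemma Phi_ext_f:
  assumes "z \<in> basin U f"
  shows "Phi_ext f P \<Phi> (f z) = Phi_ext f P \<Phi> z + 1"
proof -
  obtain n where n: "(f ^^ n) z \<in> P" using assms basin_iff by auto
  then have "(f ^^ Suc n) z \<in> P" using P_inv by simp
  then show ?thesis
    using Phi_ext_eq[of "Suc n" z] Phi_ext_eq[of n "f z"] by (simp add: funpow_swap1)
qed

lemma basin_funpow: "z \<in> basin U f \<Longrightarrow> (f ^^ n) z \<in> basin U f"
  by (induction n) (auto intro: basin_f)

lemma Phi_ext_funpow:
  "z \<in> basin U f \<Longrightarrow> Phi_ext f P \<Phi> ((f ^^ n) z) = Phi_ext f P \<Phi> z + of_nat n"
  by (induction n) (auto simp: Phi_ext_f basin_funpow)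

text \<open>The chosen entry time may jump, but on the open set \<open>D n\<close> the time
  \<open>n\<close> is admissible throughout and gives one holomorphic formula.\<close>

lemma Phi_ext_holomorphic: "Phi_ext f P \<Phi> holomorphic_on basin U f"
proof -
  define D where "D n = {z. iterate_defined U f n z} \<inter> (f ^^ n) -` P" for n
  have D: "open (D n)" for n
    unfolding D_def
    by (intro continuous_open_preimage holomorphic_on_imp_continuous_on
        holomorphic_on_iterate open_iterate_defined open_U hol_f open_P)
  have eq: "basin U f = (\<Union>n. D n)"
    using basin_iff by (auto simp: D_def)
  have "Phi_ext f P \<Phi> holomorphic_on D n" for n
  proof -
    have "(\<lambda>z. (\<Phi> \<circ> (f ^^ n)) z - of_nat n) holomorphic_on D n"
      using holomorphic_on_iterate[OF open_U hol_f, of n] \<Phi>_hol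
      by (intro holomorphic_intros holomorphic_on_compose_gen[of _ _ _ P])
        (auto simp: D_def intro: holomorphic_on_subset)
    then show ?thesis
      by (rule holomorphic_transform) (auto simp: D_def Phi_ext_eq)
  qed
  then show ?thesis
    unfolding eq using D by (intro holomorphic_on_UN_open) auto
qed

end

section \<open>Local dynamics of parabolic maps\<close>

definition inv_coord :: "complex \<Rightarrow> complex \<Rightarrow> complex" where
  "inv_coord a z = - 1 / (a * z)"

text \<open>The local inverse of a map with coefficient \<open>a\<close> has coefficient
  \<open>- a\<close>. Both dynamics can thus be followed in one plane, the map drifting right and
  its inverse left.\<close>

lemma inv_coord_minus: "inv_coord (- a) z = - inv_coord a z"
  by (simp add: inv_coord_def)

lemma norm_inv_coord: "cmod (inv_coord a z) = 1 / (cmod a * cmod z)"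
  by (simp add: inv_coord_def norm_divide norm_mult)

lemma parabolic_map_0:
  assumes "parabolic_map U f a"
  shows "f 0 = 0"
proof -
  have "(\<lambda>z. f z - (z + a * z^2)) \<in> o[nhds 0](\<lambda>z. z^2)"
    using assms by (simp add: parabolic_map_def)
  then have "\<forall>\<^sub>F z in nhds 0. cmod (f z - (z + a * z^2)) \<le> 1 * cmod (z^2)"
    by (rule landau_o.smallD) simp
  then show ?thesis
    by (drule_tac eventually_nhds_x_imp_x) simp
qed

lemma parabolic_map_asymp:
  assumes "parabolic_map U f a"
  shows "((\<lambda>z. (f z - z) / z^2) \<longlongrightarrow> a) (at 0)"
    and "((\<lambda>z. f z / z) \<longlongrightarrow> 1) (at 0)"
proof -
  have "(\<lambda>z. f z - (z + a * z^2)) \<in> o[nhds 0](\<lambda>z. z^2)"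
    using assms by (simp add: parabolic_map_def)
  then have "(\<lambda>z. f z - (z + a * z^2)) \<in> o[at 0](\<lambda>z. z^2)"
    by (rule landau_o.small.filter_mono[rotated]) (simp add: at_within_le_nhds)
  then have "((\<lambda>z. (f z - (z + a * z^2)) / z^2) \<longlongrightarrow> 0) (at 0)"
    by (rule smalloD_tendsto)
  then have "((\<lambda>z. (f z - (z + a * z^2)) / z^2 + a) \<longlongrightarrow> 0 + a) (at 0)"
    by (intro tendsto_intros)
  moreover have "\<forall>\<^sub>F z in at 0. (f z - (z + a * z^2)) / z^2 + a = (f z - z) / z^2"
    by (auto simp: eventually_at_filter field_simps)
  ultimately show 1: "((\<lambda>z. (f z - z) / z^2) \<longlongrightarrow> a) (at 0)"
    using Lim_transform_eventually by fastforce
  have "((\<lambda>z. z * ((f z - z) / z^2) + 1) \<longlongrightarrow> 0 * a + 1) (at 0)"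
    by (intro tendsto_intros 1)
  moreover have "\<forall>\<^sub>F z in at 0. z * ((f z - z) / z^2) + 1 = f z / z"
    by (auto simp: eventually_at_filter field_simps power2_eq_square)
  ultimately show "((\<lambda>z. f z / z) \<longlongrightarrow> 1) (at 0)"
    using Lim_transform_eventually by fastforce
qed

text \<open>With \<open>q = (f z - z) / z^2\<close> and \<open>p = f z / z\<close>, the deviation
  from a unit translation is exactly \<open>(q - a * p) / (a * p)\<close>, which tends to 0. The
  bound 1/4 makes the rightward drift at least 3/4, more than any vertical drift.\<close>

lemma parabolic_map_translation:
  assumes "parabolic_map U f a"
  obtains d where "d > 0"
    "\<And>z. z \<noteq> 0 \<Longrightarrow> cmod z < d \<Longrightarrow>
       f z \<noteq> 0 \<and> cmod (inv_coord a (f z) - inv_coord a z - 1) \<le> 1/4"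
proof -
  note lims = parabolic_map_asymp[OF assms]
  have a: "a \<noteq> 0" using assms by (simp add: parabolic_map_def)
  have "((\<lambda>z. ((f z - z) / z^2 - a * (f z / z)) / (a * (f z / z))) \<longlongrightarrow> (a - a * 1) / (a * 1)) (at 0)"
    using a by (intro tendsto_intros lims) auto
  then have "\<forall>\<^sub>F z in at 0. dist (((f z - z) / z^2 - a * (f z / z)) / (a * (f z / z))) 0 < 1/4"
    by (intro tendstoD) simp_all
  moreover have "\<forall>\<^sub>F z in at 0. f z / z \<noteq> 0"
    using lims(2) by (rule tendsto_imp_eventually_ne) auto
  moreover have "\<forall>\<^sub>F z in at 0. z \<noteq> (0::complex)"
    by (simp add: eventually_at_filter)
  ultimately have "\<forall>\<^sub>F z in at 0. f z \<noteq> 0 \<and>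
      cmod (inv_coord a (f z) - inv_coord a z - 1) \<le> 1/4"
  proof eventually_elim
    case (elim z)
    then have fz: "f z \<noteq> 0" by auto
    have "((f z - z) / z^2 - a * (f z / z)) / (a * (f z / z)) = inv_coord a (f z) - inv_coord a z - 1"
      using \<open>z \<noteq> 0\<close> fz a by (simp add: inv_coord_def field_simps power2_eq_square)
    with elim fz show ?case by simp
  qed
  then show thesis
    using that by (auto simp: eventually_at)
qed

section \<open>Drift of orbits in the inverted coordinate\<close>

locale drift_map =
  fixes a :: complex and \<delta> :: real and f :: "complex \<Rightarrow> complex"
  assumes a_nz: "a \<noteq> 0" and \<delta>_pos: "\<delta> > 0"
    and drift: "\<And>z. z \<noteq> 0 \<Longrightarrow> cmod z < \<delta> \<Longrightarrow>
      f z \<noteq> 0 \<and> cmod (inv_coord a (f z) - inv_coord a z - 1) \<le> 1/4"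
begin

abbreviation "u \<equiv> inv_coord a"

definition R :: real where "R = 1 / (cmod a * \<delta>)"

lemma R_pos: "R > 0"
  using a_nz \<delta>_pos by (simp add: R_def)

lemma small_iff: "z \<noteq> 0 \<Longrightarrow> cmod z < \<delta> \<longleftrightarrow> R < cmod (u z)"
  using a_nz \<delta>_pos by (simp add: norm_inv_coord R_def field_simps)

lemma step:
  assumes "z \<noteq> 0" "cmod z < \<delta>"
  shows "f z \<noteq> 0" "Re (u z) + 3/4 \<le> Re (u (f z))" "Re (u (f z)) \<le> Re (u z) + 5/4"
    "\<bar>Im (u (f z)) - Im (u z)\<bar> \<le> 1/4"
proof -
  have d: "cmod (u (f z) - u z - 1) \<le> 1/4" and fz: "f z \<noteq> 0"
    using drift[OF assms] by auto
  from fz show "f z \<noteq> 0" by simp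
  have "\<bar>Re (u (f z) - u z - 1)\<bar> \<le> 1/4" "\<bar>Im (u (f z) - u z - 1)\<bar> \<le> 1/4"
    using d abs_Re_le_cmod abs_Im_le_cmod order_trans by blast+
  then show "Re (u z) + 3/4 \<le> Re (u (f z))" "Re (u (f z)) \<le> Re (u z) + 5/4"
    "\<bar>Im (u (f z)) - Im (u z)\<bar> \<le> 1/4"
    unfolding minus_complex.sel one_complex.sel by linarith+
qed

text \<open>In the plane of \<open>u\<close>, this is the complement of a wedge opening to the left
  with tip at \<open>2 * R\<close>. Its points lie outside the disc of radius \<open>R\<close>, so
  the drift estimate applies. A step raises \<open>Re\<close> by at least 3/4 and lowers
  \<open>\<bar>Im\<bar>\<close> by at most 1/4, which makes the region forward invariant.\<close>

definition region :: "complex set" where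
  "region = {z. z \<noteq> 0 \<and> 2 * R < \<bar>Im (u z)\<bar> + Re (u z)}"

lemma region_small: "z \<in> region \<Longrightarrow> cmod z < \<delta>"
  using abs_Re_le_cmod[of "u z"] abs_Im_le_cmod[of "u z"] small_iff[of z] R_pos
  by (auto simp: region_def)

lemma region_inv:
  assumes "z \<in> region"
  shows "f z \<in> region"
proof -
  have z: "z \<noteq> 0" "2 * R < \<bar>Im (u z)\<bar> + Re (u z)"
    using assms by (auto simp: region_def)
  note st = step[OF z(1) region_small[OF assms]]
  have "2 * R < \<bar>Im (u (f z))\<bar> + Re (u (f z))"
    using z(2) st(2,4) by linarith
  with st(1) show ?thesis by (simp add: region_def)
qed

lemma region_funpow: "z \<in> region \<Longrightarrow> (f ^^ n) z \<in> region"
  by (induction n) (auto intro: region_inv)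

lemma Re_funpow:
  assumes "\<And>k. k < n \<Longrightarrow> (f ^^ k) z \<noteq> 0 \<and> cmod ((f ^^ k) z) < \<delta>"
  shows "Re (u z) + 3/4 * n \<le> Re (u ((f ^^ n) z))"
  using assms
proof (induction n)
  case (Suc n)
  then have "Re (u z) + 3/4 * n \<le> Re (u ((f ^^ n) z))" by simp
  moreover have "Re (u ((f ^^ n) z)) + 3/4 \<le> Re (u ((f ^^ Suc n) z))"
    using step(2)[of "(f ^^ n) z"] Suc.prems by simp
  ultimately show ?case unfolding of_nat_Suc by argo
qed auto

lemma region_nz: "z \<in> region \<Longrightarrow> z \<noteq> 0"
  by (simp add: region_def)

text \<open>\<open>Re (u z)\<close> grows linearly along the orbit, so \<open>u\<close> tends to
  infinity, which is the point 0 in the original coordinate.\<close>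

lemma region_lim:
  assumes "z \<in> region"
  shows "(\<lambda>n. (f ^^ n) z) \<longlonglongrightarrow> 0"
proof -
  have "Re (u z) + 3/4 * real n \<le> cmod (u ((f ^^ n) z))" for n
    using Re_funpow[of n z] region_funpow[OF assms] region_small region_nz
      complex_Re_le_cmod order_trans by meson
  moreover have "filterlim (\<lambda>n. Re (u z) + 3/4 * real n) at_top sequentially"
    by (intro filterlim_tendsto_add_at_top[OF tendsto_const]
        filterlim_tendsto_pos_mult_at_top[OF tendsto_const] filterlim_real_sequentially) auto
  ultimately have "filterlim (\<lambda>n. cmod (u ((f ^^ n) z))) at_top sequentially"
    by (auto intro: filterlim_at_top_mono)
  then have "filterlim (\<lambda>n. u ((f ^^ n) z)) at_infinity sequentially"
    using filterlim_at_infinity_conv_norm_at_top by blast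
  then have "(\<lambda>n. inverse (u ((f ^^ n) z))) \<longlonglongrightarrow> 0"
    using tendsto_inverse_0 filterlim_compose by blast
  then have "(\<lambda>n. inverse (u ((f ^^ n) z)) * (- 1 / a)) \<longlonglongrightarrow> 0 * (- 1 / a)"
    by (intro tendsto_intros)
  then show ?thesis
    using a_nz by (simp add: inv_coord_def field_simps)
qed

end

section \<open>The lifted horn map\<close>

locale horn_data =
  fixes U :: "complex set" and f :: "complex \<Rightarrow> complex" and a :: complex
    and PA :: "complex set" and \<Phi>A :: "complex \<Rightarrow> complex"
    and PR :: "complex set" and \<Phi>R :: "complex \<Rightarrow> complex"
    and V :: "complex set" and g :: "complex \<Rightarrow> complex"
  assumes par: "parabolic_map U f a"
    and att: "attracting_petal_coordinate U f PA \<Phi>A"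
    and linv: "local_inverse U f V g"
    and rep: "attracting_petal_coordinate V g PR (\<lambda>z. - \<Phi>R z)"
begin

sublocale A: petal_map U f PA \<Phi>A
  using par att parabolic_map_0[OF par] by unfold_locales (auto simp: parabolic_map_def)

sublocale B: petal_map V g PR "\<lambda>z. - \<Phi>R z"
  using linv rep by unfold_locales (auto simp: local_inverse_def)

text \<open>The extended attracting coordinate of the local inverse: \<open>- \<Theta>\<close>
  extends \<open>\<Phi>R\<close> from the repelling petal to the whole basin of
  \<open>g\<close>.\<close>

abbreviation "\<Theta> \<equiv> Phi_ext g PR (\<lambda>z. - \<Phi>R z)"
abbreviation "LD \<equiv> lifted_horn_dom U f PR \<Phi>R"
abbreviation "h \<equiv> lifted_horn f PA \<Phi>A PR \<Phi>R"

lemma f_g: "z \<in> V \<Longrightarrow> f (g z) = z" and g_U: "z \<in> V \<Longrightarrow> g z \<in> U"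
  using linv by (auto simp: local_inverse_def)

lemma funpow_f_g:
  assumes "z \<in> basin V g"
  shows "(f ^^ k) ((g ^^ k) z) = z" "iterate_defined U f k ((g ^^ k) z)"
proof -
  have "(f ^^ k) ((g ^^ k) z) = z \<and> iterate_defined U f k ((g ^^ k) z)"
  proof (induction k)
    case (Suc k)
    have "(g ^^ k) z \<in> V"
      using B.basin_funpow[OF assms] B.basin_sub by blast
    then show ?case
      using Suc f_g g_U unfolding funpow_Suc_right[of k f] iterate_defined_Suc' by simp
  qed simp
  then show "(f ^^ k) ((g ^^ k) z) = z" "iterate_defined U f k ((g ^^ k) z)" by auto
qed

lemma inj_\<Phi>R: "\<lbrakk>x \<in> PR; y \<in> PR; \<Phi>R x = \<Phi>R y\<rbrakk> \<Longrightarrow> x = y"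
  using B.\<Phi>_inj by (auto simp: inj_on_def)

text \<open>If \<open>n \<le> m\<close>, injectivity of \<open>\<Phi>R\<close> forces
  \<open>y\<close> to be the image of \<open>x\<close> under \<open>m - n\<close> steps of
  \<open>g\<close>. The additional \<open>m - n\<close> steps of \<open>f\<close> undo exactly
  these.\<close>

lemma Psi_independent:
  assumes "x \<in> PR" "y \<in> PR" "\<Phi>R x + of_nat n = \<Phi>R y + of_nat m"
  shows "(f ^^ n) x = (f ^^ m) y" "iterate_defined U f n x \<longleftrightarrow> iterate_defined U f m y"
proof -
  have *: "(f ^^ n) x = (f ^^ m) y \<and> (iterate_defined U f n x \<longleftrightarrow> iterate_defined U f m y)"
    if "x \<in> PR" "y \<in> PR" "\<Phi>R x + of_nat n = \<Phi>R y + of_nat m" "n \<le> m" for x y n m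
  proof -
    define k where "k = m - n"
    have m: "m = k + n" using that by (simp add: k_def)
    have "\<Phi>R ((g ^^ k) x) = \<Phi>R y"
      using B.\<Phi>_funpow[OF that(1), of k] that(3) by (simp add: m algebra_simps)
    then have y: "y = (g ^^ k) x"
      using inj_\<Phi>R that B.funpow_P by metis
    have "x \<in> basin V g" using that(1) B.P_subset_basin by auto
    note fg = funpow_f_g[OF this, of k]
    show ?thesis
      using fg unfolding m y add.commute[of k n] by (simp add: funpow_add add.commute[of n k] iterate_defined_add)
        (metis add.commute funpow_add o_apply)
  qed
  show "(f ^^ n) x = (f ^^ m) y" "iterate_defined U f n x \<longleftrightarrow> iterate_defined U f m y"
    using *[of x y n m] *[of y x m n] assms by (metis nat_le_linear)+
qed

lemma Psi_ext_eq:
  assumes "x \<in> PR" "\<Phi>R x = w - of_nat n"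
  shows "Psi_ext f PR \<Phi>R w = (f ^^ n) x"
    and "w \<in> Psi_ext_dom U f PR \<Phi>R \<longleftrightarrow> iterate_defined U f n x"
proof -
  define k where "k = Psi_shift PR \<Phi>R w"
  have ex: "w - of_nat n \<in> \<Phi>R ` PR" using assms by (metis imageI)
  then have "w - of_nat k \<in> \<Phi>R ` PR"
    unfolding k_def Psi_shift_def by (rule someI)
  then have k: "inv_into PR \<Phi>R (w - of_nat k) \<in> PR"
    "\<Phi>R (inv_into PR \<Phi>R (w - of_nat k)) = w - of_nat k"
    by (auto simp: inv_into_into f_inv_into_f)
  have "\<Phi>R x + of_nat n = \<Phi>R (inv_into PR \<Phi>R (w - of_nat k)) + of_nat k"
    using assms k by simp
  note ind = Psi_independent[OF assms(1) k(1) this]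
  show "Psi_ext f PR \<Phi>R w = (f ^^ n) x"
    using ind by (simp add: Psi_ext_def k_def[symmetric])
  show "w \<in> Psi_ext_dom U f PR \<Phi>R \<longleftrightarrow> iterate_defined U f n x"
    using ind ex by (auto simp: Psi_ext_dom_def k_def[symmetric])
qed

text \<open>Replaces the choices of \<open>n\<close> in the definitions of the horn map by explicit data.\<close>

definition orbit_witness :: "complex \<Rightarrow> nat \<Rightarrow> nat \<Rightarrow> complex \<Rightarrow> bool" where
  "orbit_witness w n m x \<longleftrightarrow> x \<in> PR \<and> \<Phi>R x = w - of_nat n \<and> n \<le> m \<and>
     iterate_defined U f m x \<and> (f ^^ m) x \<in> PA"

lemma orbit_witnessD:
  assumes "orbit_witness w n m x"
  shows "w \<in> LD" "h w = \<Phi>A ((f ^^ m) x) - of_nat (m - n)"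
proof -
  have x: "x \<in> PR" "\<Phi>R x = w - of_nat n" "(f ^^ m) x \<in> PA" "n \<le> m" "iterate_defined U f m x"
    using assms by (auto simp: orbit_witness_def)
  \<comment> \<open>The first \<open>n\<close> steps compute \<open>Psi_ext\<close>; the remaining
    \<open>m - n\<close> are an entry time for \<open>Phi_ext\<close>.\<close>
  have m: "m = n + (m - n)" using x by simp
  have it: "iterate_defined U f n x" "iterate_defined U f (m - n) ((f ^^ n) x)"
    using x(5) m iterate_defined_add by metis+
  have fm: "(f ^^ (m - n)) ((f ^^ n) x) = (f ^^ m) x"
    using x(4) by (metis funpow_add le_add_diff_inverse2 o_apply)
  then have "(f ^^ n) x \<in> basin U f"
    using A.basin_iff it x(3) by metis
  then show "w \<in> LD"
    using it Psi_ext_eq[OF x(1,2)] by (simp add: lifted_horn_dom_def)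
  show "h w = \<Phi>A ((f ^^ m) x) - of_nat (m - n)"
    using A.Phi_ext_eq[of "m - n" "(f ^^ n) x"] fm x(3)
    by (simp add: lifted_horn_def Psi_ext_eq[OF x(1,2)])
qed

lemma lifted_horn_dom_iff: "w \<in> LD \<longleftrightarrow> (\<exists>n m x. orbit_witness w n m x)"
proof
  assume "w \<in> LD"
  then have w: "w \<in> Psi_ext_dom U f PR \<Phi>R" "Psi_ext f PR \<Phi>R w \<in> basin U f"
    by (auto simp: lifted_horn_dom_def)
  then obtain n x where x: "x \<in> PR" "\<Phi>R x = w - of_nat n"
    by (auto simp: Psi_ext_dom_def) metis
  then have "iterate_defined U f n x" "(f ^^ n) x \<in> basin U f"
    using w Psi_ext_eq[OF x] by auto
  then obtain k where "iterate_defined U f (n + k) x" "(f ^^ (n + k)) x \<in> PA"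
    using A.basin_iff[of "(f ^^ n) x"] iterate_defined_add
    by (metis add.commute funpow_add o_apply)
  then have "orbit_witness w n (n + k) x"
    using x by (simp add: orbit_witness_def)
  then show "\<exists>n m x. orbit_witness w n m x" by blast
qed (blast intro: orbit_witnessD)

text \<open>For \<open>w + 1\<close> the same point \<open>x\<close> is iterated once more. For
  \<open>w - 1\<close> it is replaced by \<open>g x\<close>, whose coordinate is smaller by 1, and
  one step of \<open>f\<close> leads back to \<open>x\<close>.\<close>

lemma lifted_horn_shift1:
  assumes "w \<in> LD"
  shows "w + 1 \<in> LD" "h (w + 1) = h w + 1" "w - 1 \<in> LD"
proof -
  obtain n m x where wit: "orbit_witness w n m x"
    using assms lifted_horn_dom_iff by blast
  then have x: "x \<in> PR" "\<Phi>R x = w - of_nat n" "(f ^^ m) x \<in> PA" "n \<le> m" "iterate_defined U f m x"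
    by (auto simp: orbit_witness_def)
  have 1: "orbit_witness (w + 1) (Suc n) (Suc m) x"
    using x A.P_inv A.P_sub by (auto simp: orbit_witness_def iterate_defined_Suc)
  from orbit_witnessD[OF 1] show "w + 1 \<in> LD" "h (w + 1) = h w + 1"
    using orbit_witnessD[OF wit] x(3) by (auto simp: A.\<Phi>_f)
  have "g x \<in> PR" "\<Phi>R (g x) = \<Phi>R x - 1"
    using B.P_inv[OF x(1)] B.\<Phi>_f[OF x(1)] by (auto simp: algebra_simps)
  moreover have "x \<in> V" using x(1) B.P_sub by auto
  then have "(f ^^ Suc m) (g x) = (f ^^ m) x" "iterate_defined U f (Suc m) (g x)"
    using x(5) f_g g_U by (auto simp: funpow_Suc_right iterate_defined_Suc' simp del: funpow.simps(2))
  ultimately have "orbit_witness (w - 1) n (Suc m) (g x)"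
    using x by (auto simp: orbit_witness_def simp del: funpow.simps(2))
  then show "w - 1 \<in> LD" by (rule orbit_witnessD)
qed

lemma lifted_horn_shift:
  assumes "w \<in> LD"
  shows "w + of_int k \<in> LD" "h (w + of_int k) = h w + of_int k"
proof -
  have "w + of_int k \<in> LD \<and> h (w + of_int k) = h w + of_int k"
  proof (induction k rule: int_induct[of _ 0])
    case base
    then show ?case using assms by simp
  next
    case (step1 i)
    then show ?case using lifted_horn_shift1[of "w + of_int i"] by (simp add: algebra_simps)
  next
    case (step2 i)
    then have "w + of_int i - 1 \<in> LD" using lifted_horn_shift1(3) by blast
    with step2 show ?case
      using lifted_horn_shift1(2)[of "w + of_int i - 1"] by (simp add: algebra_simps)
  qed
  then show "w + of_int k \<in> LD" "h (w + of_int k) = h w + of_int k" by auto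
qed

text \<open>For fixed times \<open>n\<close> and \<open>m\<close> the witness is
  \<open>x = G (w - n)\<close> with \<open>G\<close> the inverse of \<open>\<Phi>R\<close>, so
  \<open>h\<close> is a composition of holomorphic maps on each of the open sets
  \<open>D n m\<close> that cover the domain.\<close>

lemma lifted_horn_holomorphic: "h holomorphic_on LD"
proof -
  have "\<Phi>R holomorphic_on PR"
    using holomorphic_on_minus[OF B.\<Phi>_hol] by simp
  moreover have "inj_on \<Phi>R PR"
    using inj_\<Phi>R by (auto simp: inj_on_def)
  ultimately obtain G where G: "G holomorphic_on \<Phi>R ` PR" "\<And>z. z \<in> PR \<Longrightarrow> G (\<Phi>R z) = z"
    and op: "open (\<Phi>R ` PR)"
    using holomorphic_has_inverse[OF _ B.open_P] open_mapping_thm3[OF _ B.open_P] by metis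
  define D1 where "D1 n = (\<lambda>w. w - of_nat n) -` (\<Phi>R ` PR)" for n :: nat
  define S where "S m = {z. iterate_defined U f m z} \<inter> (f ^^ m) -` PA" for m
  define D where "D n m = D1 n \<inter> (\<lambda>w. G (w - of_nat n)) -` S m" for n m
  have D1: "open (D1 n)" for n
    unfolding D1_def by (intro open_vimage op continuous_intros)
  have S: "open (S m)" for m
    unfolding S_def
    by (intro continuous_open_preimage holomorphic_on_imp_continuous_on
        holomorphic_on_iterate open_iterate_defined A.open_U A.hol_f A.open_P)
  have G': "(G \<circ> (\<lambda>w. w - of_nat n)) holomorphic_on D1 n" for n
    by (intro holomorphic_on_compose_gen[OF _ G(1)] holomorphic_intros) (auto simp: D1_def)
  have D: "open (D n m)" for n m
    unfolding D_def
    using holomorphic_on_imp_continuous_on[OF G'[of n]] D1 S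
    by (intro continuous_open_preimage) (auto simp: o_def)
  have wit: "orbit_witness w n m (G (w - of_nat n))" if "w \<in> D n m" "n \<le> m" for w n m
    using that G(2) by (auto simp: D_def D1_def S_def orbit_witness_def)
  have eq: "LD = (\<Union>(n, m)\<in>{(n, m). n \<le> m}. D n m)"
  proof (intro set_eqI iffI)
    fix w assume "w \<in> LD"
    then obtain n m x where "orbit_witness w n m x"
      using lifted_horn_dom_iff by blast
    then have x: "x \<in> PR" "\<Phi>R x = w - of_nat n" "(f ^^ m) x \<in> PA" "n \<le> m" "iterate_defined U f m x"
      by (auto simp: orbit_witness_def)
    then have "G (w - of_nat n) = x" using G(2)[OF x(1)] by simp
    then have "w \<in> D n m"
      using x by (auto simp: D_def D1_def S_def) (metis imageI)
    with x(4) show "w \<in> (\<Union>(n, m)\<in>{(n, m). n \<le> m}. D n m)" by auto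
  qed (use wit orbit_witnessD in blast)
  have "h holomorphic_on D n m" if "n \<le> m" for n m
  proof -
    have "(f ^^ m) holomorphic_on S m"
      using holomorphic_on_iterate[OF A.open_U A.hol_f, of m]
      by (rule holomorphic_on_subset) (auto simp: S_def)
    then have "((\<Phi>A \<circ> (f ^^ m)) \<circ> (G \<circ> (\<lambda>w. w - of_nat n))) holomorphic_on D n m"
      by (intro holomorphic_on_compose_gen[of _ _ _ "S m"] holomorphic_on_compose_gen[of _ _ _ PA]
          holomorphic_on_subset[OF G'] A.\<Phi>_hol) (auto simp: D_def S_def)
    then have "(\<lambda>w. ((\<Phi>A \<circ> (f ^^ m)) \<circ> (G \<circ> (\<lambda>w. w - of_nat n))) w - of_nat (m - n)) holomorphic_on D n m"
      by (intro holomorphic_intros)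
    then show ?thesis
    proof (rule holomorphic_transform)
      fix w assume "w \<in> D n m"
      from orbit_witnessD(2)[OF wit[OF this that]]
      show "((\<Phi>A \<circ> (f ^^ m)) \<circ> (G \<circ> (\<lambda>w. w - of_nat n))) w - of_nat (m - n) = h w"
        by simp
    qed
  qed
  then show ?thesis
    unfolding eq using D by (intro holomorphic_on_UN_open) auto
qed

end

section \<open>Orbits near the ends\<close>

text \<open>One disc for both directions: inside it \<open>f\<close> and \<open>g\<close> are
  defined and drift oppositely, and \<open>g\<close> undoes every step of \<open>f\<close> that
  stays in it.\<close>

locale local_horn_data = horn_data U f a PA \<Phi>A PR \<Phi>R V g +
    F: drift_map a \<delta> f + G: drift_map "- a" \<delta> g
  for U f a PA \<Phi>A PR \<Phi>R V g \<delta> +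
  assumes ball_U: "ball 0 \<delta> \<subseteq> U" and ball_V: "ball 0 \<delta> \<subseteq> V"
    and g_f: "\<lbrakk>cmod x < \<delta>; cmod (f x) < \<delta>\<rbrakk> \<Longrightarrow> g (f x) = x"
begin

lemma G_R: "G.R = F.R"
  by (simp add: G.R_def F.R_def)

text \<open>The two regions are mirror images in the plane of \<open>F.u\<close>. They meet in an
  upper and a lower wedge, whose points have controlled orbits in both time directions.\<close>

lemma G_region_iff: "z \<in> G.region \<longleftrightarrow> z \<noteq> 0 \<and> 2 * F.R < \<bar>Im (F.u z)\<bar> - Re (F.u z)"
  by (auto simp: G.region_def G_R inv_coord_minus)

lemma F_region_basin: "z \<in> F.region \<Longrightarrow> z \<in> basin U f"
  unfolding basin_def iterate_defined_def
  using F.region_funpow[of z] F.region_small F.region_lim F.region_nz ball_U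
  by (auto simp: subset_iff)

lemma G_region_basin: "z \<in> G.region \<Longrightarrow> z \<in> basin V g"
  unfolding basin_def iterate_defined_def
  using G.region_funpow[of z] G.region_small G.region_lim G.region_nz ball_V
  by (auto simp: subset_iff)

lemma funpow_g_f:
  assumes "\<And>k. k \<le> n \<Longrightarrow> cmod ((f ^^ k) x) < \<delta>"
  shows "(g ^^ n) ((f ^^ n) x) = x"
  using assms
proof (induction n)
  case (Suc n)
  have "(g ^^ Suc n) ((f ^^ Suc n) x) = (g ^^ n) (g (f ((f ^^ n) x)))"
    by (simp add: funpow_Suc_right del: funpow.simps(2)) (simp add: funpow_swap1)
  also have "\<dots> = x"
    using g_f[of "(f ^^ n) x"] Suc.prems[of n] Suc.prems[of "Suc n"] Suc by simp
  finally show ?case .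
qed simp

text \<open>The bound on \<open>t\<close> places the box to the left of \<open>- 2 * F.R\<close>. It
  therefore corresponds to a compact subset of \<open>G.region\<close>, on which
  \<open>\<Theta>\<close> is continuous.\<close>

lemma Theta_bounded_on_box:
  assumes "t > 2 * F.R + 2"
  obtains M where
    "\<And>z. \<lbrakk>z \<noteq> 0; - t \<le> Re (F.u z); Re (F.u z) \<le> - t + 2; \<bar>Im (F.u z)\<bar> \<le> 2 * t\<rbrakk> \<Longrightarrow> cmod (\<Theta> z) \<le> M"
proof -
  define S where "S = cbox (Complex (- t) (- 2 * t)) (Complex (- t + 2) (2 * t))"
  define K where "K = (\<lambda>v. - 1 / (a * v)) ` S"
  have S: "v \<in> S \<longleftrightarrow> - t \<le> Re v \<and> Re v \<le> - t + 2 \<and> \<bar>Im v\<bar> \<le> 2 * t" for v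
    by (auto simp: S_def in_cbox_complex_iff)
  have nz: "v \<noteq> 0" if "v \<in> S" for v
    using that S[of v] assms F.R_pos by auto
  have u: "F.u (- 1 / (a * v)) = v" if "v \<noteq> 0" for v
    using that F.a_nz by (simp add: inv_coord_def)
  have "compact K"
    unfolding K_def using nz F.a_nz
    by (intro compact_continuous_image continuous_intros) (auto simp: S_def)
  have "K \<subseteq> G.region"
    unfolding K_def image_subset_iff G_region_iff
    using u nz S F.a_nz assms F.R_pos by fastforce
  then have "continuous_on K \<Theta>"
    using B.Phi_ext_holomorphic G_region_basin
    by (meson continuous_on_subset holomorphic_on_imp_continuous_on subset_iff)
  then have "bounded (\<Theta> ` K)"
    using \<open>compact K\<close> compact_continuous_image compact_imp_bounded by blast
  then obtain M where M: "\<And>z. z \<in> K \<Longrightarrow> cmod (\<Theta> z) \<le> M"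
    by (auto simp: bounded_iff)
  show thesis
  proof (rule that, rule M)
    fix z assume z: "z \<noteq> 0" "- t \<le> Re (F.u z)" "Re (F.u z) \<le> - t + 2" "\<bar>Im (F.u z)\<bar> \<le> 2 * t"
    then have "F.u z \<in> S" by (simp add: S)
    moreover have "z = - 1 / (a * F.u z)"
      using z F.a_nz by (simp add: inv_coord_def)
    ultimately show "z \<in> K" unfolding K_def by blast
  qed
qed

text \<open>The backward orbit tends to 0, so it stays in the small disc from some time
  \<open>N\<close> on. From then on each step of \<open>g\<close> moves \<open>F.u\<close> to the
  left by at least 3/4.\<close>

lemma backward_orbit_Re_at_bot:
  assumes "z \<in> basin V g"
  obtains i where "Re (F.u ((g ^^ i) z)) < - t"
proof -
  have "(\<lambda>n. (g ^^ n) z) \<longlonglongrightarrow> 0" and nz: "\<And>n. (g ^^ n) z \<noteq> 0"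
    using assms by (auto simp: basin_def)
  then have "\<forall>\<^sub>F n in sequentially. cmod ((g ^^ n) z) < \<delta>"
    using G.\<delta>_pos tendstoD[of "\<lambda>n. (g ^^ n) z" 0 sequentially \<delta>] by simp
  then obtain N where N: "\<And>n. n \<ge> N \<Longrightarrow> cmod ((g ^^ n) z) < \<delta>"
    by (auto simp: eventually_sequentially)
  have comp: "(g ^^ k) ((g ^^ N) z) = (g ^^ (k + N)) z" for k
    by (simp add: funpow_add)
  obtain n :: nat where "4/3 * (t - Re (G.u ((g ^^ N) z))) < real n"
    using reals_Archimedean2 by blast
  moreover have "Re (G.u ((g ^^ N) z)) + 3/4 * real n \<le> Re (G.u ((g ^^ (n + N)) z))"
    using G.Re_funpow[of n "(g ^^ N) z"] N nz unfolding comp by simp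
  ultimately have "t < Re (G.u ((g ^^ (n + N)) z))"
    by argo
  then show thesis
    using that[of "n + N"] by (simp add: inv_coord_minus)
qed

text \<open>A step moves \<open>F.u\<close> to the right by at least 3/4 and at most 5/4, so the
  orbit reaches the strip and cannot jump over its width 2.\<close>

lemma first_crossing:
  assumes "z \<noteq> 0" "Re (F.u z) < - t" "t > 2 * F.R + 2"
  obtains j where "(f ^^ j) z \<noteq> 0" "- t \<le> Re (F.u ((f ^^ j) z))" "Re (F.u ((f ^^ j) z)) \<le> - t + 2"
    "\<And>k. k \<le> j \<Longrightarrow> (f ^^ k) z \<in> G.region"
proof -
  have small: "cmod x < \<delta>" if "x \<noteq> 0" "Re (F.u x) < - t" for x
    using that assms(3) F.small_iff[OF that(1)] abs_Re_le_cmod[of "F.u x"] F.R_pos by auto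
  have nz: "(f ^^ k) z \<noteq> 0" if "\<And>i. i < k \<Longrightarrow> Re (F.u ((f ^^ i) z)) < - t" for k
    using that
  proof (induction k)
    case (Suc k)
    then show ?case using F.step(1)[of "(f ^^ k) z"] small[of "(f ^^ k) z"] by simp
  qed (use assms in simp)
  have ex: "\<exists>j. - t \<le> Re (F.u ((f ^^ j) z))"
  proof (rule ccontr)
    assume "\<nexists>j. - t \<le> Re (F.u ((f ^^ j) z))"
    then have less: "Re (F.u ((f ^^ k) z)) < - t" for k by (meson not_le)
    obtain n :: nat where "4/3 * (- t - Re (F.u z)) < real n"
      using reals_Archimedean2 by blast
    moreover have "Re (F.u z) + 3/4 * real n \<le> Re (F.u ((f ^^ n) z))"
      using nz small less by (intro F.Re_funpow) auto
    ultimately show False using less[of n] by argo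
  qed
  define j where "j = (LEAST j. - t \<le> Re (F.u ((f ^^ j) z)))"
  have j: "- t \<le> Re (F.u ((f ^^ j) z))"
    unfolding j_def using ex by (rule LeastI_ex)
  have less: "Re (F.u ((f ^^ k) z)) < - t" if "k < j" for k
    using not_less_Least that unfolding j_def by (metis not_le)
  \<comment> \<open>The start lies strictly to the left of the strip, so the crossing time is
    positive and the preceding point is still to the left.\<close>
  obtain i where i: "j = Suc i"
    using j assms(2) by (cases j) auto
  have "Re (F.u (f ((f ^^ i) z))) \<le> Re (F.u ((f ^^ i) z)) + 5/4"
    using F.step(3) small nz less i by (metis lessI less_trans)
  then have j2: "Re (F.u ((f ^^ j) z)) \<le> - t + 2"
    using less[of i] i by simp
  have "(f ^^ k) z \<in> G.region" if "k \<le> j" for k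
  proof -
    have "Re (F.u ((f ^^ k) z)) \<le> - t + 2"
      using that less[of k] j2 by (cases "k = j") auto
    moreover have "(f ^^ k) z \<noteq> 0" using nz less that by auto
    ultimately show ?thesis using assms(3) by (auto simp: G_region_iff)
  qed
  with j j2 nz less show thesis using that by blast
qed

text \<open>
  The strip where backward orbits are stopped lies to the left of the disc where the dynamics is not
  controlled. Points of the strip with bounded imaginary part form a compact set, on which \<open>\<Theta>\<close> is
  bounded, so a large imaginary part of \<open>\<Phi>R x\<close> forces the crossing point into both regions.
\<close>

lemma orbit_through_both_regions:
  obtains M where
    "\<And>x. \<lbrakk>x \<in> PR; M < \<bar>Im (\<Phi>R x)\<bar>\<rbrakk> \<Longrightarrow>
       \<exists>z k. z \<in> F.region \<and> z \<in> G.region \<and> - \<Theta> z = \<Phi>R x + of_int k"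
proof -
  \<comment> \<open>At a crossing point \<open>Re\<close> is at least \<open>- t\<close>; if also
    \<open>\<bar>Im\<bar>\<close> exceeds \<open>2 * t\<close>, their sum exceeds \<open>t\<close>,
    hence \<open>2 * F.R\<close>, which is membership in \<open>F.region\<close>.\<close>
  define t where "t = 2 * F.R + 3"
  have t: "t > 2 * F.R + 2" by (simp add: t_def)
  obtain M where M: "\<And>z. \<lbrakk>z \<noteq> 0; - t \<le> Re (F.u z); Re (F.u z) \<le> - t + 2; \<bar>Im (F.u z)\<bar> \<le> 2 * t\<rbrakk>
      \<Longrightarrow> cmod (\<Theta> z) \<le> M"
    using Theta_bounded_on_box[OF t] by blast
  have "\<exists>z k. z \<in> F.region \<and> z \<in> G.region \<and> - \<Theta> z = \<Phi>R x + of_int k"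
    if x: "x \<in> PR" "M < \<bar>Im (\<Phi>R x)\<bar>" for x
  proof -
    have xb: "x \<in> basin V g" using x B.P_subset_basin by auto
    \<comment> \<open>The point is first moved far left by \<open>i\<close> steps of
      \<open>g\<close> and then by \<open>j\<close> steps of \<open>f\<close> into the strip. Both
      moves change \<open>\<Theta>\<close> by an integer only.\<close>
    obtain i where i: "Re (F.u ((g ^^ i) x)) < - t"
      using backward_orbit_Re_at_bot[OF xb] by blast
    define y where "y = (g ^^ i) x"
    have y0: "y \<noteq> 0" using xb by (simp add: y_def basin_def)
    obtain j where j: "(f ^^ j) y \<noteq> 0" "- t \<le> Re (F.u ((f ^^ j) y))"
        "Re (F.u ((f ^^ j) y)) \<le> - t + 2" "\<And>k. k \<le> j \<Longrightarrow> (f ^^ k) y \<in> G.region"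
      using first_crossing[OF y0 i[folded y_def] t] by blast
    define z where "z = (f ^^ j) y"
    have "(g ^^ j) z = y"
      unfolding z_def using j(4) G.region_small by (intro funpow_g_f) auto
    moreover have zG: "z \<in> G.region" using j(4)[of j] by (simp add: z_def)
    ultimately have "\<Theta> y = \<Theta> z + of_nat j"
      using B.Phi_ext_funpow[OF G_region_basin] by metis
    moreover have "\<Theta> y = - \<Phi>R x + of_nat i"
      unfolding y_def using B.Phi_ext_funpow[OF xb] B.Phi_ext_P[OF x(1)] by simp
    ultimately have eq: "- \<Theta> z = \<Phi>R x + of_int (int j - int i)"
      by (simp add: algebra_simps)
    have "\<not> \<bar>Im (F.u z)\<bar> \<le> 2 * t"
    proof
      assume "\<bar>Im (F.u z)\<bar> \<le> 2 * t"
      then have "cmod (\<Theta> z) \<le> M" using M j by (simp add: z_def)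
      moreover have "\<bar>Im (\<Phi>R x)\<bar> = \<bar>Im (\<Theta> z)\<bar>"
        using arg_cong[OF eq, of Im] by simp
      ultimately show False using x(2) abs_Im_le_cmod[of "\<Theta> z"] by linarith
    qed
    then have "z \<in> F.region"
      using j F.R_pos by (auto simp: F.region_def z_def t_def)
    with zG eq show ?thesis by blast
  qed
  then show thesis using that by blast
qed

text \<open>Equal attracting coordinates make the forward orbits merge in \<open>PA\<close>. Both
  orbits remain in the disc where \<open>g\<close> undoes \<open>f\<close>, so the merged point can
  be pulled back and the starting points agree up to iteration.\<close>

lemma Phi_ext_diff_Ints_imp_Theta:
  assumes z: "z1 \<in> F.region" "z2 \<in> F.region" "z1 \<in> G.region" "z2 \<in> G.region"
    and int: "Phi_ext f PA \<Phi>A z1 - Phi_ext f PA \<Phi>A z2 \<in> \<int>"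
  shows "\<Theta> z1 - \<Theta> z2 \<in> \<int>"
proof -
  have main: "\<Theta> y = \<Theta> x + of_nat j"
    if xy: "x \<in> F.region" "y \<in> F.region" "x \<in> G.region"
      and eq: "Phi_ext f PA \<Phi>A x = Phi_ext f PA \<Phi>A y + of_nat j" for x y j
  proof -
    \<comment> \<open>Iterating \<open>y\<close> absorbs the integer difference and leaves two
      points with the same value of \<open>Phi_ext\<close>.\<close>
    define y' where "y' = (f ^^ j) y"
    have y': "y' \<in> F.region" unfolding y'_def using xy by (intro F.region_funpow)
    have eq': "Phi_ext f PA \<Phi>A x = Phi_ext f PA \<Phi>A y'"
      using eq A.Phi_ext_funpow[OF F_region_basin] xy by (simp add: y'_def)
    obtain n1 n2 where "(f ^^ n1) x \<in> PA" "(f ^^ n2) y' \<in> PA"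
      using A.basin_iff F_region_basin xy y' by metis
    then have n: "(f ^^ (max n1 n2)) x \<in> PA" "(f ^^ (max n1 n2)) y' \<in> PA"
      by (meson A.funpow_P_mono max.cobounded1 max.cobounded2)+
    define n where "n = max n1 n2"
    have "\<Phi>A ((f ^^ n) x) = \<Phi>A ((f ^^ n) y')"
      using eq' n A.Phi_ext_eq by (simp add: n_def)
    then have "(f ^^ n) x = (f ^^ n) y'"
      using A.\<Phi>_inj n by (auto simp: inj_on_def n_def)
    moreover have "(g ^^ n) ((f ^^ n) x) = x" "(g ^^ n) ((f ^^ n) y') = y'"
      using F.region_funpow F.region_small xy y' by (auto intro!: funpow_g_f)
    ultimately have "x = (f ^^ j) y" by (simp add: y'_def)
    moreover have "(g ^^ j) ((f ^^ j) y) = y"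
      using F.region_funpow F.region_small xy by (auto intro!: funpow_g_f)
    ultimately show ?thesis
      using B.Phi_ext_funpow[OF G_region_basin[OF xy(3)], of j] by simp
  qed
  obtain k where k: "Phi_ext f PA \<Phi>A z1 - Phi_ext f PA \<Phi>A z2 = of_int k"
    using int by (auto elim: Ints_cases)
  show ?thesis
  proof (cases "k \<ge> 0")
    case True
    then have "Phi_ext f PA \<Phi>A z1 = Phi_ext f PA \<Phi>A z2 + of_nat (nat k)"
      using k by (simp add: algebra_simps)
    from main[OF z(1,2,3) this] show ?thesis by simp
  next
    case False
    then have "Phi_ext f PA \<Phi>A z2 = Phi_ext f PA \<Phi>A z1 + of_nat (nat (- k))"
      using k by (simp add: algebra_simps)
    from main[OF z(2,1,4) this] show ?thesis by simp
  qed
qed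

text \<open>Some \<open>(g ^^ n) z\<close> lies in the repelling petal, and \<open>n\<close> steps
  of \<open>f\<close> bring it back to \<open>z\<close>; thus \<open>Psi_ext\<close> sends
  \<open>- \<Theta> z\<close> to \<open>z\<close>.\<close>

lemma lifted_horn_eq_Phi_ext:
  assumes "z \<in> G.region" "z \<in> F.region"
  shows "- \<Theta> z \<in> LD" "h (- \<Theta> z) = Phi_ext f PA \<Phi>A z"
proof -
  note zb = G_region_basin[OF assms(1)]
  obtain n where n: "(g ^^ n) z \<in> PR"
    using B.basin_iff zb by auto
  have w: "\<Phi>R ((g ^^ n) z) = - \<Theta> z - of_nat n"
    using B.Phi_ext_eq[OF n] by simp
  note Psi = Psi_ext_eq[OF n w] and fg = funpow_f_g[OF zb, of n]
  show "- \<Theta> z \<in> LD" "h (- \<Theta> z) = Phi_ext f PA \<Phi>A z"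
    using Psi fg F_region_basin[OF assms(2)]
    by (auto simp: lifted_horn_dom_def lifted_horn_def)
qed

text \<open>Up to an integer translation, a point of the domain far from the real axis is
  \<open>- \<Theta> z\<close> with \<open>z\<close> in both regions. There \<open>h\<close> becomes
  \<open>Phi_ext\<close>, whose value modulo integers determines \<open>\<Theta> z\<close> modulo
  integers.\<close>

lemma injective_near_ends:
  obtains M where "\<And>w1 w2. \<lbrakk>w1 \<in> LD; w2 \<in> LD; M < \<bar>Im w1\<bar>; M < \<bar>Im w2\<bar>; h w1 - h w2 \<in> \<int>\<rbrakk>
    \<Longrightarrow> w1 - w2 \<in> \<int>"
proof -
  obtain M where M: "\<And>x. \<lbrakk>x \<in> PR; M < \<bar>Im (\<Phi>R x)\<bar>\<rbrakk> \<Longrightarrow>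
       \<exists>z k. z \<in> F.region \<and> z \<in> G.region \<and> - \<Theta> z = \<Phi>R x + of_int k"
    using orbit_through_both_regions by blast
  have ex: "\<exists>z k. z \<in> F.region \<and> z \<in> G.region \<and> - \<Theta> z = w + of_int k \<and>
      Phi_ext f PA \<Phi>A z = h w + of_int k"
    if w: "w \<in> LD" "M < \<bar>Im w\<bar>" for w
  proof -
    obtain n m x where "orbit_witness w n m x"
      using w lifted_horn_dom_iff by blast
    then have x: "x \<in> PR" "\<Phi>R x = w - of_nat n"
      by (auto simp: orbit_witness_def)
    then have "M < \<bar>Im (\<Phi>R x)\<bar>" using w by simp
    from M[OF x(1) this] obtain z k
      where z: "z \<in> F.region" "z \<in> G.region" "- \<Theta> z = \<Phi>R x + of_int k" by blast
    have "- \<Theta> z = w + of_int (k - int n)"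
      using z(3) x(2) by simp
    with z lifted_horn_eq_Phi_ext[OF z(2,1)] lifted_horn_shift[OF w(1), of "k - int n"]
    show ?thesis by metis
  qed
  show thesis
  proof (rule that)
    fix w1 w2 assume w: "w1 \<in> LD" "w2 \<in> LD" "M < \<bar>Im w1\<bar>" "M < \<bar>Im w2\<bar>" "h w1 - h w2 \<in> \<int>"
    obtain z1 k1 where 1: "z1 \<in> F.region" "z1 \<in> G.region" "- \<Theta> z1 = w1 + of_int k1"
      "Phi_ext f PA \<Phi>A z1 = h w1 + of_int k1" using ex w by blast
    obtain z2 k2 where 2: "z2 \<in> F.region" "z2 \<in> G.region" "- \<Theta> z2 = w2 + of_int k2"
      "Phi_ext f PA \<Phi>A z2 = h w2 + of_int k2" using ex w by blast
    have "Phi_ext f PA \<Phi>A z1 - Phi_ext f PA \<Phi>A z2 = (h w1 - h w2) + (of_int k1 - of_int k2)"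
      using 1 2 by simp
    also have "\<dots> \<in> \<int>" 
      using Ints_add[OF w(5) Ints_of_int[of "k1 - k2"]] by simp
    finally have "\<Theta> z1 - \<Theta> z2 \<in> \<int>"
      using Phi_ext_diff_Ints_imp_Theta 1 2 by blast
    moreover have "\<Theta> z1 = - (w1 + of_int k1)" "\<Theta> z2 = - (w2 + of_int k2)"
      using 1(3) 2(3) by (metis minus_minus)+
    then have "w1 - w2 = - (\<Theta> z1 - \<Theta> z2) - (of_int k1 - of_int k2)"
      by simp
    ultimately show "w1 - w2 \<in> \<int>"
      by (metis Ints_diff Ints_minus Ints_of_int)
  qed
qed

end

section \<open>A common radius for the map and its local inverse\<close>

context horn_data
begin

lemma ex_local_horn_data: "\<exists>\<delta>. local_horn_data U f a PA \<Phi>A PR \<Phi>R V g \<delta>"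
proof -
  have a: "a \<noteq> 0" and U: "open U" "0 \<in> U" "f holomorphic_on U"
    using par by (auto simp: parabolic_map_def)
  have V: "open V" "0 \<in> V" "g holomorphic_on V" and g0: "g 0 = 0"
    using linv by (auto simp: local_inverse_def)
  obtain d where d: "d > 0" "\<And>z. z \<noteq> 0 \<Longrightarrow> cmod z < d \<Longrightarrow>
       f z \<noteq> 0 \<and> cmod (inv_coord a (f z) - inv_coord a z - 1) \<le> 1/4"
    using parabolic_map_translation[OF par] by blast
  have "(f has_field_derivative 1) (at 0)"
    using parabolic_map_asymp(2)[OF par] by (simp add: has_field_derivative_iff)
  then have "deriv f 0 \<noteq> 0" by (simp add: DERIV_imp_deriv)
  then obtain r where r: "r > 0" "ball 0 r \<subseteq> U" "inj_on f (ball 0 r)"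
    using has_complex_derivative_locally_injective[OF U(3,2,1)] by blast
  obtain \<rho> where \<rho>: "\<rho> > 0" "ball 0 \<rho> \<subseteq> V"
    using V openE by blast
  have "isCont g 0"
    using V holomorphic_on_imp_continuous_on continuous_on_eq_continuous_at by blast
  then obtain e where e: "e > 0" "\<And>z. cmod z < e \<Longrightarrow> cmod (g z) < min d r"
    using d r g0 unfolding continuous_at_eps_delta by (metis diff_zero dist_norm min_less_iff_conj)
  \<comment> \<open>\<open>d\<close> gives the drift of \<open>f\<close>, \<open>r\<close> its
    injectivity, \<open>\<rho>\<close> the domain of \<open>g\<close>, and \<open>e\<close> sends
    values of \<open>g\<close> into the disc where the first two hold.\<close>
  define \<delta> where "\<delta> = min (min d r) (min \<rho> e)"
  have "local_horn_data U f a PA \<Phi>A PR \<Phi>R V g \<delta>"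
  proof unfold_locales
    show "\<delta> > 0" using d r \<rho> e by (simp add: \<delta>_def)
    show "a \<noteq> 0" "- a \<noteq> 0" using a by auto
    show "ball 0 \<delta> \<subseteq> U" "ball 0 \<delta> \<subseteq> V"
      using r \<rho> by (auto simp: \<delta>_def)
    show "f z \<noteq> 0 \<and> cmod (inv_coord a (f z) - inv_coord a z - 1) \<le> 1/4"
      if "z \<noteq> 0" "cmod z < \<delta>" for z
      using that d by (simp add: \<delta>_def)
    \<comment> \<open>The drift of \<open>g\<close> at \<open>z\<close> is that of \<open>f\<close>
      at \<open>g z\<close>, since \<open>f (g z) = z\<close> and the coordinate changes
      sign.\<close>
    show "g z \<noteq> 0 \<and> cmod (inv_coord (- a) (g z) - inv_coord (- a) z - 1) \<le> 1/4"
      if z: "z \<noteq> 0" "cmod z < \<delta>" for z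
    proof -
      have "z \<in> V" using z \<rho> by (auto simp: \<delta>_def)
      then have fg: "f (g z) = z" by (rule f_g)
      then have "g z \<noteq> 0" using z(1) A.f_0 by metis
      moreover have "cmod (g z) < d" using e(2)[of z] z by (simp add: \<delta>_def)
      ultimately have "cmod (inv_coord a (f (g z)) - inv_coord a (g z) - 1) \<le> 1/4"
        using d(2) by blast
      then show ?thesis
        using \<open>g z \<noteq> 0\<close> by (simp add: fg inv_coord_minus)
    qed
    show "g (f x) = x" if x: "cmod x < \<delta>" "cmod (f x) < \<delta>" for x
    proof -
      have "f x \<in> V" using x \<rho> by (auto simp: \<delta>_def)
      then have "f (g (f x)) = f x" by (rule f_g)
      moreover have "cmod (g (f x)) < r" using e(2)[of "f x"] x by (simp add: \<delta>_def)
      ultimately show ?thesis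
        using r(3) x by (auto simp: inj_on_def \<delta>_def)
    qed
  qed
  then show ?thesis by blast
qed

lemma lifted_horn_injective_near_ends:
  obtains M where "\<And>w1 w2. \<lbrakk>w1 \<in> LD; w2 \<in> LD; M < \<bar>Im w1\<bar>; M < \<bar>Im w2\<bar>; h w1 - h w2 \<in> \<int>\<rbrakk>
    \<Longrightarrow> w1 - w2 \<in> \<int>"
  using ex_local_horn_data local_horn_data.injective_near_ends by metis

end

section \<open>The ends of the cylinder\<close>

text \<open>The limit 0 would mean that the real part of \<open>G\<close> tends to minus infinity.
  In this form the existence of a single-valued logarithm excludes a zero limit.\<close>

lemma exp_not_tendsto_0_at_singularity:
  assumes "r > 0" "G holomorphic_on ball z r - {z}"
  shows "\<not> ((\<lambda>w. exp (G w)) \<longlongrightarrow> 0) (at z)"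
proof
  assume "((\<lambda>w. exp (G w)) \<longlongrightarrow> 0) (at z)"
  then have "((\<lambda>w. exp (Re (G w))) \<longlongrightarrow> 0) (at z)"
    using tendsto_norm_zero by (fastforce simp: norm_exp_eq_Re)
  then have "filterlim (\<lambda>w. exp (Re (G w))) (at_right 0) (at z)"
    by (simp add: filterlim_at)
  then have "filterlim (\<lambda>w. ln (exp (Re (G w)))) at_bot (at z)"
    using ln_at_0 filterlim_compose by blast
  then show False
    using Re_not_at_bot_at_singularity[OF assms] by simp
qed

section \<open>The exponential chart and its logarithm\<close>

definition end_exp :: "int \<Rightarrow> complex \<Rightarrow> complex" where
  "end_exp s w = exp (2 * of_real pi * \<i> * of_int s * w)"

text \<open>A discontinuous section of \<open>end_exp s\<close>; its jumps are integers, hence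
  invisible to functions of period 1.\<close>

definition end_log :: "int \<Rightarrow> complex \<Rightarrow> complex" where
  "end_log s z = Ln z / (2 * of_real pi * \<i> * of_int s)"

lemma end_coord_to_cylinder: "end_coord s (to_cylinder w) = end_exp s w"
  unfolding end_exp_def by transfer simp

lemma to_cylinder_eq_iff: "to_cylinder v = to_cylinder w \<longleftrightarrow> v - w \<in> \<int>"
  by transfer simp

lemma to_cylinder_add: "to_cylinder (v + w) = to_cylinder v + to_cylinder w"
  by transfer simp

lemma ex_to_cylinder: "\<exists>w. x = to_cylinder w"
  by transfer (metis Ints_0 diff_self)

lemma end_exp_nz [simp]: "end_exp s w \<noteq> 0"
  by (simp add: end_exp_def)

lemma end_exp_add: "end_exp s (v + w) = end_exp s v * end_exp s w"
  by (simp add: end_exp_def exp_add distrib_left)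

lemma end_exp_minus: "end_exp (- s) w = inverse (end_exp s w)"
  by (simp add: end_exp_def exp_minus)

lemma norm_end_exp: "cmod (end_exp s w) = exp (- 2 * pi * (of_int s * Im w))"
  by (simp add: end_exp_def)

lemma end_exp_end_log: "\<lbrakk>s \<noteq> 0; z \<noteq> 0\<rbrakk> \<Longrightarrow> end_exp s (end_log s z) = z"
  by (simp add: end_exp_def end_log_def)

lemma end_exp_holomorphic [holomorphic_intros]:
  "k holomorphic_on A \<Longrightarrow> (\<lambda>w. end_exp s (k w)) holomorphic_on A"
  unfolding end_exp_def by (intro holomorphic_intros)

lemma end_exp_eq_iff:
  assumes "s = 1 \<or> s = - 1"
  shows "end_exp s v = end_exp s w \<longleftrightarrow> v - w \<in> \<int>"
proof
  assume "end_exp s v = end_exp s w"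
  then obtain n :: int where
    "2 * of_real pi * \<i> * of_int s * v = 2 * of_real pi * \<i> * of_int s * w + of_real (of_int (2 * n) * pi) * \<i>"
    unfolding end_exp_def exp_eq by auto
  then have "(2 * of_real pi * \<i>) * (of_int s * v) = (2 * of_real pi * \<i>) * (of_int s * w + of_int n)"
    by (simp add: algebra_simps)
  then have "of_int s * v = of_int s * w + of_int n" by simp
  then have "v - w = of_int (s * n)" using assms by (auto simp: algebra_simps)
  then show "v - w \<in> \<int>" by simp
next
  assume "v - w \<in> \<int>"
  then have "to_cylinder v = to_cylinder w" by (simp add: to_cylinder_eq_iff)
  then show "end_exp s v = end_exp s w" by (metis end_coord_to_cylinder)
qed

lemma inj_end_coord:
  assumes "s = 1 \<or> s = - 1" "end_coord s x = end_coord s y"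
  shows "x = y"
  using assms ex_to_cylinder[of x] ex_to_cylinder[of y]
  by (auto simp: end_coord_to_cylinder end_exp_eq_iff to_cylinder_eq_iff)

lemma end_log_end_exp:
  assumes "s = 1 \<or> s = - 1"
  obtains n where "end_log s (end_exp s w) = w + of_int n"
proof -
  have "end_log s (end_exp s w) - w \<in> \<int>"
    using assms end_exp_end_log[of s "end_exp s w"] by (subst end_exp_eq_iff[symmetric, OF assms]) auto
  then show thesis using that by (auto elim!: Ints_cases simp: algebra_simps)
qed

lemma end_log_far:
  assumes "s \<noteq> 0" "z \<noteq> 0" "cmod z < exp (- 2 * pi * M)"
  shows "M < of_int s * Im (end_log s z)"
proof -
  have "cmod z = exp (- 2 * pi * (of_int s * Im (end_log s z)))"
    using norm_end_exp end_exp_end_log assms by metis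
  then have "- 2 * pi * (of_int s * Im (end_log s z)) < - 2 * pi * M"
    using assms(3) by simp
  then show ?thesis by simp
qed

locale end_sign =
  fixes s :: int
  assumes s: "s = 1 \<or> s = - 1"
begin

lemma s_nz: "s \<noteq> 0" using s by auto

lemma end_exp_image_iff:
  assumes "\<And>w n. w \<in> D \<Longrightarrow> w + of_int n \<in> D"
  shows "z \<in> end_exp s ` D \<longleftrightarrow> z \<noteq> 0 \<and> end_log s z \<in> D"
proof
  assume "z \<in> end_exp s ` D"
  then obtain w where "w \<in> D" "z = end_exp s w" by auto
  then show "z \<noteq> 0 \<and> end_log s z \<in> D"
    using end_log_end_exp[OF s, of w] assms by (metis end_exp_nz)
next
  assume "z \<noteq> 0 \<and> end_log s z \<in> D"
  then show "z \<in> end_exp s ` D"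
    using end_exp_end_log s_nz by (metis imageI)
qed

text \<open>By periodicity the branch of the logarithm does not affect the value, so near each point
  \<open>end_log\<close> may be replaced by a holomorphic branch.\<close>

lemma holomorphic_on_end_log:
  assumes k: "k holomorphic_on D"
    and D: "\<And>w n. w \<in> D \<Longrightarrow> w + of_int n \<in> D"
    and per: "\<And>w n. w \<in> D \<Longrightarrow> k (w + of_int n) = k w"
  shows "(\<lambda>z. k (end_log s z)) holomorphic_on end_exp s ` D"
  unfolding holomorphic_on_def
proof
  fix z0 assume z0: "z0 \<in> end_exp s ` D"
  then have nz: "z0 \<noteq> 0" by auto
  define B where "B = ball z0 (cmod z0)"
  \<comment> \<open>Dividing by \<open>z0\<close> moves the disc \<open>B\<close> to the unit disc
    about 1, which misses the cut of the principal logarithm.\<close>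
  define L where "L z = end_log s z0 + end_log s (z / z0)" for z
  have B: "open B" "z0 \<in> B" using nz by (auto simp: B_def)
  have slit: "z / z0 \<notin> \<real>\<^sub>\<le>\<^sub>0" if "z \<in> B" for z
  proof
    assume neg: "z / z0 \<in> \<real>\<^sub>\<le>\<^sub>0"
    have "cmod (1 - z / z0) = cmod (z0 - z) / cmod z0"
      using nz by (simp add: norm_divide[symmetric] diff_divide_distrib)
    also have "\<dots> < 1" using that nz by (simp add: B_def dist_norm)
    finally have "cmod (1 - z / z0) < 1" .
    moreover have "Re (1 - z / z0) \<ge> 1" using neg by (auto simp: complex_nonpos_Reals_iff)
    ultimately show False using complex_Re_le_cmod[of "1 - z / z0"] by linarith
  qed
  have L_hol: "L holomorphic_on B"
    unfolding L_def end_log_def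
    by (intro holomorphic_intros) (use slit nz s_nz in auto)
  have eL: "end_exp s (L z) = z" if "z \<in> B" for z
  proof -
    have "z \<noteq> 0" using that by (auto simp: B_def)
    then show ?thesis
      unfolding L_def end_exp_add using nz s_nz by (simp add: end_exp_end_log)
  qed
  have LD: "L z \<in> D \<and> k (L z) = k (end_log s z)" if "z \<in> B \<inter> end_exp s ` D" for z
  proof -
    have "z \<noteq> 0" "end_log s z \<in> D" using that end_exp_image_iff[of D z] D by auto
    moreover from this have "end_exp s (L z) = end_exp s (end_log s z)"
      using eL that s_nz by (simp add: end_exp_end_log)
    then obtain n where "L z = end_log s z + of_int n"
      using end_exp_eq_iff[OF s] by (auto elim!: Ints_cases simp: algebra_simps)
    ultimately show ?thesis using D per by metis
  qed
  have "(k \<circ> L) holomorphic_on (B \<inter> end_exp s ` D)"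
    using L_hol LD by (intro holomorphic_on_compose_gen[OF _ k]) (auto intro: holomorphic_on_subset)
  then have "(\<lambda>z. k (end_log s z)) holomorphic_on (B \<inter> end_exp s ` D)"
    by (rule holomorphic_transform) (use LD in auto)
  then have "(\<lambda>z. k (end_log s z)) field_differentiable at z0 within (B \<inter> end_exp s ` D)"
    using z0 B by (simp add: holomorphic_on_def)
  moreover have "at z0 within (B \<inter> end_exp s ` D) = at z0 within (end_exp s ` D)"
    by (rule at_within_nhd[OF B(2,1)]) auto
  ultimately show "(\<lambda>z. k (end_log s z)) field_differentiable at z0 within (end_exp s ` D)"
    by simp
qed

lemma eventually_cylinder_end:
  "(\<forall>\<^sub>F x in cylinder_end s. P x) \<longleftrightarrow> (\<exists>M. \<forall>w. M < of_int s * Im w \<longrightarrow> P (to_cylinder w))"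
  by (simp add: cylinder_end_def eventually_filtermap eventually_filtercomap_at_top_dense)

lemma filterlim_end_coord: "filterlim (end_coord s) (at 0) (cylinder_end s)"
  unfolding filterlim_at tendsto_iff
proof (intro conjI allI impI)
  show "\<forall>\<^sub>F x in cylinder_end s. end_coord s x \<in> UNIV \<and> end_coord s x \<noteq> 0"
    by (simp add: eventually_cylinder_end end_coord_to_cylinder)
  fix e :: real assume "e > 0"
  show "\<forall>\<^sub>F x in cylinder_end s. dist (end_coord s x) 0 < e"
    unfolding eventually_cylinder_end
  proof (intro exI allI impI)
    fix w assume "- ln e / (2 * pi) < of_int s * Im w"
    then have "- 2 * pi * (of_int s * Im w) < ln e" by (simp add: field_simps)
    then show "dist (end_coord s (to_cylinder w)) 0 < e"
      using \<open>e > 0\<close> by (metis dist_0_norm dist_commute end_coord_to_cylinder exp_less_mono exp_ln norm_end_exp)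
  qed
qed

end

section \<open>Asymptotics of horn maps at the ends\<close>

locale horn_end = horn_data U f a PA \<Phi>A PR \<Phi>R V g + end_sign s
  for U f a PA \<Phi>A PR \<Phi>R V g s
begin

definition H :: "complex \<Rightarrow> complex" where
  "H z = end_exp s (h (end_log s z))"

definition \<Omega> :: "complex set" where
  "\<Omega> = end_exp s ` LD"

lemma H_nz: "H z \<noteq> 0" by (simp add: H_def)

lemma \<Omega>_iff: "z \<in> \<Omega> \<longleftrightarrow> z \<noteq> 0 \<and> end_log s z \<in> LD"
  unfolding \<Omega>_def using lifted_horn_shift by (intro end_exp_image_iff)

lemma end_exp_h_shift: "w \<in> LD \<Longrightarrow> end_exp s (h (w + of_int n)) = end_exp s (h w)"
  by (simp add: lifted_horn_shift end_exp_eq_iff[OF s])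

lemma H_end_exp: "w \<in> LD \<Longrightarrow> H (end_exp s w) = end_exp s (h w)"
  unfolding H_def by (rule end_log_end_exp[OF s, of w]) (simp add: end_exp_h_shift)

lemma end_exp_\<Omega>_iff: "end_exp s w \<in> \<Omega> \<longleftrightarrow> w \<in> LD"
proof
  assume "end_exp s w \<in> \<Omega>"
  then obtain n where "w + of_int n \<in> LD"
    using end_log_end_exp[OF s, of w] by (metis \<Omega>_iff)
  from lifted_horn_shift(1)[OF this, of "- n"] show "w \<in> LD" by simp
qed (simp add: \<Omega>_def)

lemma H_hol: "H holomorphic_on \<Omega>"
  unfolding H_def \<Omega>_def
  by (rule holomorphic_on_end_log[where k = "\<lambda>w. end_exp s (h w)"])
    (simp_all add: end_exp_holomorphic lifted_horn_holomorphic lifted_horn_shift(1) end_exp_h_shift)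

text \<open>Near a nonzero \<open>l\<close> the chart is inverted locally, so the puncture lifts to
  one of the domain of \<open>h\<close>, and a multiple of \<open>h\<close> is a single-valued
  logarithm of \<open>H\<close>.\<close>

lemma H_not_tendsto_0_at_puncture:
  assumes "l \<noteq> 0" "\<rho> > 0" "ball l \<rho> - {l} \<subseteq> \<Omega>"
  shows "\<not> (H \<longlongrightarrow> 0) (at l)"
proof
  assume lim: "(H \<longlongrightarrow> 0) (at l)"
  define w0 where "w0 = end_log s l"
  have el: "end_exp s w0 = l" using assms s_nz by (simp add: w0_def end_exp_end_log)
  have cont: "isCont (end_exp s) w0"
    unfolding end_exp_def by (intro continuous_intros)
  then obtain d where d: "d > 0" "\<And>w. dist w w0 < d \<Longrightarrow> dist (end_exp s w) l < \<rho>"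
    using assms(2) unfolding continuous_at_eps_delta el by metis
  \<comment> \<open>The bound 1 keeps the other preimages of \<open>l\<close>, the integer
    translates of \<open>w0\<close>, out of the disc.\<close>
  define e where "e = min d 1"
  have ne: "end_exp s w \<noteq> l" if "w \<in> ball w0 e - {w0}" for w
  proof
    assume "end_exp s w = l"
    then have "w - w0 \<in> \<int>" using el end_exp_eq_iff[OF s] by metis
    then obtain n where n: "w - w0 = of_int n" by (auto elim: Ints_cases)
    have "cmod (w - w0) < 1" using that by (simp add: e_def dist_norm norm_minus_commute)
    then have "n = 0" unfolding n by simp
    with n that show False by simp
  qed
  have sub: "ball w0 e - {w0} \<subseteq> LD"
  proof
    fix w assume w: "w \<in> ball w0 e - {w0}"
    then have "end_exp s w \<in> \<Omega>"
      using ne[OF w] d(2)[of w] assms(3) by (auto simp: e_def dist_commute)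
    then show "w \<in> LD" by (simp add: end_exp_\<Omega>_iff)
  qed
  have e: "e > 0" using d by (simp add: e_def)
  have ev: "\<forall>\<^sub>F w in at w0. w \<in> ball w0 e - {w0}"
    using e by (auto simp: eventually_at dist_commute)
  have "filterlim (end_exp s) (at l) (at w0)"
    unfolding filterlim_at
  proof
    show "\<forall>\<^sub>F w in at w0. end_exp s w \<in> UNIV \<and> end_exp s w \<noteq> l"
      using ev by eventually_elim (use ne in auto)
    show "(end_exp s \<longlongrightarrow> l) (at w0)" using cont el by (simp add: isCont_def)
  qed
  then have "((\<lambda>w. H (end_exp s w)) \<longlongrightarrow> 0) (at w0)"
    by (rule filterlim_compose[OF lim])
  moreover have "\<forall>\<^sub>F w in at w0. H (end_exp s w) = exp (2 * of_real pi * \<i> * of_int s * h w)"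
    using ev by eventually_elim (use sub H_end_exp in \<open>auto simp: end_exp_def\<close>)
  ultimately have "((\<lambda>w. exp (2 * of_real pi * \<i> * of_int s * h w)) \<longlongrightarrow> 0) (at w0)"
    by (rule Lim_transform_eventually)
  moreover have "(\<lambda>w. 2 * of_real pi * \<i> * of_int s * h w) holomorphic_on ball w0 e - {w0}"
    using lifted_horn_holomorphic sub by (intro holomorphic_intros) (auto intro: holomorphic_on_subset)
  ultimately show False
    using exp_not_tendsto_0_at_singularity[OF e] by blast
qed

lemma H_asymp:
  assumes far: "\<And>w. M0 < of_int s * Im w \<Longrightarrow> w \<in> LD"
  obtains c where "c \<noteq> 0" "((\<lambda>z. H z / z) \<longlongrightarrow> c) (at 0)"
proof -
  obtain M where M: "\<And>w1 w2. \<lbrakk>w1 \<in> LD; w2 \<in> LD; M < \<bar>Im w1\<bar>; M < \<bar>Im w2\<bar>; h w1 - h w2 \<in> \<int>\<rbrakk>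
    \<Longrightarrow> w1 - w2 \<in> \<int>"
    using lifted_horn_injective_near_ends by blast
  \<comment> \<open>Under the chart, the punctured disc of radius \<open>r\<close> is the half-plane
    beyond \<open>max M0 M\<close>, in which \<open>h\<close> is defined and injective modulo
    integers.\<close>
  define r where "r = exp (- 2 * pi * max M0 M)"
  have r: "r > 0" by (simp add: r_def)
  have LD: "end_log s z \<in> LD" and Im: "M < \<bar>Im (end_log s z)\<bar>" if "z \<in> ball 0 r - {0}" for z
  proof -
    have "max M0 M < of_int s * Im (end_log s z)"
      using that s_nz by (intro end_log_far) (auto simp: r_def)
    then show "end_log s z \<in> LD" "M < \<bar>Im (end_log s z)\<bar>"
      using far s by auto
  qed
  have sub: "ball 0 r - {0} \<subseteq> \<Omega>"
    using LD unfolding \<Omega>_iff subset_iff by blast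
  have inj: "z1 = z2" if "z1 \<in> ball 0 r - {0}" "z2 \<in> ball 0 r - {0}" "H z1 = H z2" for z1 z2
  proof -
    have "h (end_log s z1) - h (end_log s z2) \<in> \<int>"
      using that(3) by (simp add: H_def end_exp_eq_iff[OF s])
    then have "end_log s z1 - end_log s z2 \<in> \<int>"
      using M LD Im that by blast
    then have "end_exp s (end_log s z1) = end_exp s (end_log s z2)"
      by (simp add: end_exp_eq_iff[OF s])
    then show ?thesis using that s_nz by (simp add: end_exp_end_log)
  qed
  have hol: "H holomorphic_on ball 0 (r/2) - {0}"
    using r by (intro holomorphic_on_subset[OF H_hol] order_trans[OF _ sub]) auto
  \<comment> \<open>The second omitted value for Picard's theorem is attained on the boundary
    circle, so injectivity excludes it inside.\<close>
  have omit: "H w \<noteq> 0 \<and> H w \<noteq> H (of_real (r/2))" if "w \<in> ball 0 (r/2) - {0}" for w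
  proof -
    have "cmod (of_real (r/2) :: complex) = r/2" using r by simp
    moreover have "cmod w < r/2" using that by simp
    ultimately have "w \<noteq> of_real (r/2)" by (metis less_irrefl)
    moreover have "w \<in> ball 0 r - {0}" "of_real (r/2) \<in> ball (0::complex) r - {0}"
      using that r by auto
    ultimately show ?thesis using inj H_nz by blast
  qed
  obtain l where l: "(H \<longlongrightarrow> l) (at 0) \<or> ((inverse \<circ> H) \<longlongrightarrow> l) (at 0)"
  proof (rule great_Picard[OF open_ball _ not_sym[OF H_nz] hol omit])
    show "0 \<in> ball 0 (r/2)" using r by simp
  qed (use that in blast)+
  \<comment> \<open>A logarithm of \<open>H z / z\<close>, single-valued because
    \<open>h w - w\<close> has period 1.\<close>
  define G where "G z = 2 * of_real pi * \<i> * of_int s * (h (end_log s z) - end_log s z)" for z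
  have "(\<lambda>z. G z) holomorphic_on \<Omega>"
    unfolding G_def \<Omega>_def
    by (rule holomorphic_on_end_log[where k = "\<lambda>w. 2 * of_real pi * \<i> * of_int s * (h w - w)"])
      (simp_all add: holomorphic_intros lifted_horn_holomorphic lifted_horn_shift)
  then have G: "G holomorphic_on ball 0 r - {0}"
    using sub by (rule holomorphic_on_subset)
  have expG: "exp (G z) = H z / z" if "z \<noteq> 0" for z
  proof -
    have "exp (G z) = H z / end_exp s (end_log s z)"
      by (simp add: G_def H_def end_exp_def exp_diff[symmetric] right_diff_distrib)
    then show ?thesis using that s_nz by (simp add: end_exp_end_log)
  qed
  have not0: "\<not> ((\<lambda>z. H z / z) \<longlongrightarrow> 0) (at 0)"
  proof
    assume "((\<lambda>z. H z / z) \<longlongrightarrow> 0) (at 0)"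
    then have "((\<lambda>z. exp (G z)) \<longlongrightarrow> 0) (at 0)"
      by (rule Lim_transform_eventually) (auto simp: expG eventually_at_filter)
    then show False using exp_not_tendsto_0_at_singularity[OF r G] by blast
  qed
  \<comment> \<open>A finite limit of \<open>1/H\<close> would make
    \<open>z / H z = exp (- G z)\<close> tend to 0.\<close>
  have not_inv: "\<not> ((inverse \<circ> H) \<longlongrightarrow> l) (at 0)" for l
  proof
    assume "((inverse \<circ> H) \<longlongrightarrow> l) (at 0)"
    then have "((\<lambda>z. z * (inverse \<circ> H) z) \<longlongrightarrow> 0 * l) (at 0)"
      by (intro tendsto_intros)
    then have "((\<lambda>z. exp (- G z)) \<longlongrightarrow> 0) (at 0)"
      unfolding mult_zero_left
      by (rule Lim_transform_eventually) (auto simp: expG exp_minus eventually_at_filter divide_inverse)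
    moreover have "(\<lambda>z. - G z) holomorphic_on ball 0 r - {0}"
      using G by (rule holomorphic_on_minus)
    ultimately show False using exp_not_tendsto_0_at_singularity[OF r] by blast
  qed
  \<comment> \<open>A nonzero limit of \<open>H\<close> would give a limit of \<open>1/H\<close>, so
    only 0 remains.\<close>
  have lim0: "(H \<longlongrightarrow> 0) (at 0)"
  proof (cases "l = 0")
    case True
    then show ?thesis using l not_inv by auto
  next
    case False
    have "(H \<longlongrightarrow> l) (at 0)" using l not_inv by auto
    then have "((inverse \<circ> H) \<longlongrightarrow> inverse l) (at 0)"
      using False by (auto simp: o_def intro: tendsto_intros)
    then show ?thesis using not_inv by auto
  qed
  define H0 where "H0 z = (if z = 0 then 0 else H z)" for z
  have "H0 holomorphic_on ball 0 r"
    unfolding H0_def using lim0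
    by (intro removable_singularity holomorphic_on_subset[OF H_hol sub]) auto
  then have "(H0 has_field_derivative deriv H0 0) (at 0)"
    using r by (intro holomorphic_derivI[of _ "ball 0 r"]) auto
  then have "((\<lambda>z. H0 z / z) \<longlongrightarrow> deriv H0 0) (at 0)"
    by (simp add: has_field_derivative_iff H0_def)
  then have lim: "((\<lambda>z. H z / z) \<longlongrightarrow> deriv H0 0) (at 0)"
    by (rule Lim_transform_eventually) (auto simp: H0_def eventually_at_filter)
  show thesis
  proof (rule that[OF _ lim])
    show "deriv H0 0 \<noteq> 0"
    proof
      assume "deriv H0 0 = 0"
      with lim not0 show False by simp
    qed
  qed
qed

lemma opposite_end: "horn_end U f a PA \<Phi>A PR \<Phi>R V g (- s)"
proof (intro horn_end.intro end_sign.intro)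
  show "horn_data U f a PA \<Phi>A PR \<Phi>R V g" by (rule horn_data_axioms)
  show "- s = 1 \<or> - s = - 1" using s by arith
qed

text \<open>A neighbourhood of infinity in \<open>\<Omega>\<close> is one of the opposite end. In
  the reciprocal chart the horn map tends to 0 there, hence \<open>H\<close> tends to
  infinity.\<close>

lemma H_not_tendsto_0_at_infinity:
  assumes "\<And>y. \<rho> < cmod y \<Longrightarrow> y \<in> \<Omega>"
  shows "\<not> (H \<longlongrightarrow> 0) at_infinity"
proof
  assume lim: "(H \<longlongrightarrow> 0) at_infinity"
  interpret opp: horn_end U f a PA \<Phi>A PR \<Phi>R V g "- s"
    by (rule opposite_end)
  \<comment> \<open>Beyond this height towards the opposite end, the modulus of
    \<open>end_exp s w\<close> exceeds \<open>max 1 \<rho>\<close>; the 1 keeps the argument of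
    \<open>ln\<close> positive.\<close>
  define M1 where "M1 = ln (max 1 \<rho>) / (2 * pi)"
  have far: "w \<in> LD" if "M1 < of_int (- s) * Im w" for w
  proof -
    have "ln (max 1 \<rho>) < of_int (- s) * Im w * (2 * pi)"
      using that unfolding M1_def by (subst (asm) pos_divide_less_eq) simp_all
    then have "exp (ln (max 1 \<rho>)) < cmod (end_exp s w)"
      unfolding norm_end_exp by (simp only: exp_less_cancel_iff) (simp add: mult_ac)
    then have "max 1 \<rho> < cmod (end_exp s w)" by simp
    then have "end_exp s w \<in> \<Omega>" using assms by simp
    then show ?thesis by (simp add: end_exp_\<Omega>_iff)
  qed
  obtain c where "c \<noteq> 0" and c: "((\<lambda>z. opp.H z / z) \<longlongrightarrow> c) (at 0)"
    using opp.H_asymp[OF far] by blast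
  have "((\<lambda>z. z * (opp.H z / z)) \<longlongrightarrow> 0 * c) (at 0)"
    by (intro tendsto_intros c)
  moreover have "((\<lambda>z. H (inverse z)) \<longlongrightarrow> 0) (at 0)"
    by (rule filterlim_compose[OF lim filterlim_inverse_at_infinity])
  ultimately have "((\<lambda>z. (z * (opp.H z / z)) * H (inverse z)) \<longlongrightarrow> 0 * c * 0) (at 0)"
    by (rule tendsto_mult)
  \<comment> \<open>The two charts are reciprocal, so this product is constantly 1, although both
    factors would tend to 0.\<close>
  moreover have "\<forall>\<^sub>F z in at 0. (z * (opp.H z / z)) * H (inverse z) = 1"
    unfolding eventually_at
  proof (intro exI conjI ballI impI)
    show "exp (- 2 * pi * M1) > (0::real)" by simp
    fix z :: complex assume z: "z \<noteq> 0 \<and> dist z 0 < exp (- 2 * pi * M1)"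
    define w where "w = end_log (- s) z"
    have "M1 < of_int (- s) * Im w"
      unfolding w_def using z s_nz by (intro end_log_far) auto
    then have w: "w \<in> LD" by (rule far)
    have "end_exp (- s) w = z" using z s_nz by (simp add: w_def end_exp_end_log)
    then have "inverse z = end_exp s w" by (auto simp: end_exp_minus)
    then have "H (inverse z) = inverse (opp.H z)"
      using H_end_exp[OF w] by (simp add: opp.H_def w_def[symmetric] end_exp_minus)
    then show "(z * (opp.H z / z)) * H (inverse z) = 1"
      using z opp.H_nz[of z] by simp
  qed
  ultimately have "((\<lambda>z::complex. 1::complex) \<longlongrightarrow> 0 * c * 0) (at 0)"
    by (rule Lim_transform_eventually)
  then show False
    using tendsto_const_iff[of "at (0::complex)" "1::complex" 0] by simp
qed

lemma end_coord_horn: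
  assumes "x \<in> horn_dom U f PR \<Phi>R"
  shows "end_coord s x \<in> \<Omega>" "end_coord s (horn U f PA \<Phi>A PR \<Phi>R x) = H (end_coord s x)"
proof -
  define w where "w = (SOME w. w \<in> LD \<and> to_cylinder w = x)"
  have "\<exists>w. w \<in> LD \<and> to_cylinder w = x"
    using assms by (auto simp: horn_dom_def)
  then have w: "w \<in> LD \<and> to_cylinder w = x"
    unfolding w_def by (rule someI_ex)
  then have z: "end_coord s x = end_exp s w"
    using end_coord_to_cylinder by metis
  show "end_coord s x \<in> \<Omega>"
    unfolding z using w by (simp add: end_exp_\<Omega>_iff)
  have "horn U f PA \<Phi>A PR \<Phi>R x = to_cylinder (h w)"
    unfolding horn_def w_def ..
  then show "end_coord s (horn U f PA \<Phi>A PR \<Phi>R x) = H (end_coord s x)"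
    unfolding z using w by (simp add: end_coord_to_cylinder H_end_exp)
qed

end

section \<open>Solutions of the functional equation\<close>

text \<open>Dynamics enters through the asymptotics of \<open>H1\<close> and \<open>H2\<close> and
  through \<open>puncture\<close> and \<open>infinity\<close>; the argument itself is the theory of
  isolated singularities.\<close>

lemma semiconjugacy_asymp:
  assumes r: "r > 0" and F: "F holomorphic_on ball 0 r - {0}"
    and F_\<Omega>: "\<And>z. z \<in> ball 0 r - {0} \<Longrightarrow> F z \<in> \<Omega>"
    and H2: "continuous_on \<Omega> H2" "\<And>y. H2 y \<noteq> 0" and \<Omega>_0: "0 \<notin> \<Omega>" "\<Omega> \<noteq> {}"
    and eq: "\<And>z. z \<in> ball 0 r - {0} \<Longrightarrow> H1 z = \<kappa> * H2 (F z)" and \<kappa>: "\<kappa> \<noteq> 0"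
    and H1_asymp: "((\<lambda>z. H1 z / z) \<longlongrightarrow> c1) (at 0)" "c1 \<noteq> 0"
    and H2_asymp: "((\<lambda>z. H2 z / z) \<longlongrightarrow> c2) (at 0)" "c2 \<noteq> 0"
    and puncture: "\<And>l \<rho>. \<lbrakk>l \<noteq> 0; \<rho> > 0; ball l \<rho> - {l} \<subseteq> \<Omega>\<rbrakk> \<Longrightarrow> \<not> (H2 \<longlongrightarrow> 0) (at l)"
    and infinity: "\<And>\<rho>. (\<And>y. \<rho> < cmod y \<Longrightarrow> y \<in> \<Omega>) \<Longrightarrow> \<not> (H2 \<longlongrightarrow> 0) at_infinity"
  obtains c where "c \<noteq> 0" "((\<lambda>z. F z / z) \<longlongrightarrow> c) (at 0)"
proof -
  have ev: "\<forall>\<^sub>F z in at 0. z \<in> ball 0 r - {0}"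
    using r by (auto simp: eventually_at dist_commute intro!: exI[of _ r])
  have "((\<lambda>z. z * (H1 z / z) / \<kappa>) \<longlongrightarrow> 0 * c1 / \<kappa>) (at 0)"
    using \<kappa> by (intro tendsto_intros H1_asymp)
  then have "((\<lambda>z. z * (H1 z / z) / \<kappa>) \<longlongrightarrow> 0) (at 0)" by simp
  then have lim: "((\<lambda>z. H2 (F z)) \<longlongrightarrow> 0) (at 0)"
  proof (rule Lim_transform_eventually)
    show "\<forall>\<^sub>F z in at 0. z * (H1 z / z) / \<kappa> = H2 (F z)"
      using ev by eventually_elim (use eq \<kappa> in auto)
  qed
  have small: "\<exists>\<rho>>0. \<rho> \<le> r \<and> (\<forall>z\<in>ball 0 \<rho> - {0}. cmod (H2 (F z)) < e)" if "e > 0" for e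
  proof -
    have "\<forall>\<^sub>F z in at 0. dist (H2 (F z)) 0 < e" using lim that by (rule tendstoD)
    then obtain d where "d > 0" "\<And>z. z \<noteq> 0 \<Longrightarrow> dist z 0 < d \<Longrightarrow> dist (H2 (F z)) 0 < e"
      by (auto simp: eventually_at)
    then show ?thesis using r by (intro exI[of _ "min d r"]) (auto simp: dist_norm)
  qed
  have F_hol: "F holomorphic_on ball 0 \<rho> - {0}" if "\<rho> \<le> r" for \<rho>
    using that by (intro holomorphic_on_subset[OF F]) auto
  \<comment> \<open>Otherwise the values of \<open>F\<close> near 0 would be dense and approach some
    \<open>y0\<close> in \<open>\<Omega>\<close>, near which \<open>H2\<close> is bounded away from
    0, whereas \<open>H2 (F z)\<close> tends to 0.\<close>
  obtain l where "(F \<longlongrightarrow> l) (at 0) \<or> ((inverse \<circ> F) \<longlongrightarrow> l) (at 0)"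
  proof (rule ccontr)
    assume neg: "\<not> thesis"
    obtain y0 where y0: "y0 \<in> \<Omega>" using \<Omega>_0 by auto
    have pos: "cmod (H2 y0) / 2 > 0" using H2 by simp
    obtain d where d: "d > 0" "\<And>y. y \<in> \<Omega> \<Longrightarrow> dist y y0 < d \<Longrightarrow> dist (H2 y) (H2 y0) < cmod (H2 y0) / 2"
      using H2(1) y0 pos unfolding continuous_on_iff by metis
    obtain \<rho> where \<rho>: "\<rho> > 0" "\<rho> \<le> r" "\<And>z. z \<in> ball 0 \<rho> - {0} \<Longrightarrow> cmod (H2 (F z)) < cmod (H2 y0) / 2"
      using small[OF pos] by blast
    have "closure (F ` (ball 0 \<rho> - {0})) = UNIV"
    proof (rule Casorati_Weierstrass[OF open_ball _ F_hol])
      show "\<not> (F \<longlongrightarrow> l) (at 0)" "\<not> ((inverse \<circ> F) \<longlongrightarrow> l) (at 0)" for l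
        using neg that by blast+
    qed (use \<rho> in auto)
    then have "y0 \<in> closure (F ` (ball 0 \<rho> - {0}))" by simp
    then obtain z where z: "z \<in> ball 0 \<rho> - {0}" "dist (F z) y0 < d"
      using d(1) unfolding closure_approachable by blast
    have "F z \<in> \<Omega>" using z \<rho> by (intro F_\<Omega>) auto
    then have "dist (H2 (F z)) (H2 y0) < cmod (H2 y0) / 2" using d z by blast
    moreover have "cmod (H2 y0) \<le> cmod (H2 (F z)) + dist (H2 (F z)) (H2 y0)"
      by (metis dist_commute dist_norm norm_triangle_sub)
    ultimately show False using \<rho>(3)[OF z(1)] by linarith
  qed
  then consider (inf) "((inverse \<circ> F) \<longlongrightarrow> 0) (at 0)" | (fin) l where "(F \<longlongrightarrow> l) (at 0)"
  proof (elim disjE)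
    assume inv: "((inverse \<circ> F) \<longlongrightarrow> l) (at 0)"
    show ?thesis
    proof (cases "l = 0")
      case False
      have "((\<lambda>z. inverse ((inverse \<circ> F) z)) \<longlongrightarrow> inverse l) (at 0)"
        using inv False by (rule tendsto_inverse)
      then show ?thesis using that(2) by simp
    qed (use inv that in auto)
  qed (use that in auto)
  then show thesis
  proof cases
    case inf
    define K where "K z = (if z = 0 then 0 else (inverse \<circ> F) z)" for z
    have F_nz: "F z \<noteq> 0" if "z \<in> ball 0 r - {0}" for z
      using F_\<Omega>[OF that] \<Omega>_0 by metis
    have "(inverse \<circ> F) holomorphic_on ball 0 r - {0}"
      unfolding o_def using F F_nz by (rule holomorphic_on_inverse)
    then have K: "K holomorphic_on ball 0 r"
      unfolding K_def by (intro removable_singularity[OF _ open_ball inf])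
    \<comment> \<open>The radius \<open>r\<close> puts a neighbourhood of infinity into
      \<open>\<Omega>\<close>; small radii show that \<open>H2\<close> is small near
      infinity.\<close>
    have image: "\<exists>e>0. \<forall>y. 1 / e < cmod y \<longrightarrow> y \<in> F ` (ball 0 \<rho> - {0})"
      if \<rho>: "\<rho> > 0" "\<rho> \<le> r" for \<rho>
    proof -
      have "K holomorphic_on ball 0 \<rho>" using \<rho> by (intro holomorphic_on_subset[OF K]) auto
      moreover have "K w \<noteq> K 0" if "w \<in> ball 0 \<rho> - {0}" for w
        using that \<rho> F_nz[of w] by (auto simp: K_def)
      ultimately obtain e where e: "e > 0" "ball (K 0) e \<subseteq> K ` ball 0 \<rho>"
        using open_image_punctured_nhd[OF \<rho>(1)] by metis
      have "y \<in> F ` (ball 0 \<rho> - {0})" if y: "1 / e < cmod y" for y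
      proof -
        have "y \<noteq> 0" using y e(1) by (auto simp: field_simps)
        have "inverse y \<in> ball (K 0) e"
          using y e(1) \<open>y \<noteq> 0\<close> by (simp add: K_def norm_divide field_simps)
        then obtain z where z: "z \<in> ball 0 \<rho>" "inverse y = K z" using e(2) by blast
        then have "z \<noteq> 0" using \<open>y \<noteq> 0\<close> by (auto simp: K_def)
        then have "y = F z" using z(2) by (simp add: K_def)
        then show ?thesis using z \<open>z \<noteq> 0\<close> by blast
      qed
      then show ?thesis using e(1) by blast
    qed
    obtain e where e: "\<And>y. 1 / e < cmod y \<Longrightarrow> y \<in> F ` (ball 0 r - {0})"
      using image[OF r order_refl] by blast
    have "y \<in> \<Omega>" if "1 / e < cmod y" for y
      using e[OF that] F_\<Omega> by blast
    moreover have "(H2 \<longlongrightarrow> 0) at_infinity"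
      unfolding tendsto_iff eventually_at_infinity
    proof (intro allI impI)
      fix \<epsilon> :: real assume "\<epsilon> > 0"
      obtain \<rho> where \<rho>: "\<rho> > 0" "\<rho> \<le> r" "\<forall>z\<in>ball 0 \<rho> - {0}. cmod (H2 (F z)) < \<epsilon>"
        using small[OF \<open>\<epsilon> > 0\<close>] by blast
      obtain e where e: "\<And>y. 1 / e < cmod y \<Longrightarrow> y \<in> F ` (ball 0 \<rho> - {0})"
        using image[OF \<rho>(1,2)] by blast
      show "\<exists>b. \<forall>y. b \<le> cmod y \<longrightarrow> dist (H2 y) 0 < \<epsilon>"
      proof (intro exI allI impI)
        fix y assume "1 / e + 1 \<le> cmod y"
        then have "y \<in> F ` (ball 0 \<rho> - {0})" by (intro e) linarith
        then show "dist (H2 y) 0 < \<epsilon>" using \<rho>(3) by auto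
      qed
    qed
    ultimately show thesis using infinity[of "1 / e"] by simp
  next
    case (fin l)
    show thesis
    proof (cases "l = 0")
      case True
      \<comment> \<open>Since \<open>F\<close> never vanishes, the asymptotics of \<open>H2\<close>
        at 0 can be composed with \<open>F\<close>.\<close>
      have "filterlim F (at 0) (at 0)"
        unfolding filterlim_at
      proof
        show "\<forall>\<^sub>F z in at 0. F z \<in> UNIV \<and> F z \<noteq> 0"
          using ev by eventually_elim (use F_\<Omega> \<Omega>_0 in force)
        show "(F \<longlongrightarrow> 0) (at 0)" using fin True by simp
      qed
      then have "((\<lambda>z. H2 (F z) / F z) \<longlongrightarrow> c2) (at 0)"
        by (rule filterlim_compose[OF H2_asymp(1)])
      then have "((\<lambda>z. (H1 z / z) / (\<kappa> * (H2 (F z) / F z))) \<longlongrightarrow> c1 / (\<kappa> * c2)) (at 0)"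
        using \<kappa> H2_asymp(2) by (intro tendsto_intros H1_asymp) auto
      moreover have "\<forall>\<^sub>F z in at 0. (H1 z / z) / (\<kappa> * (H2 (F z) / F z)) = F z / z"
        using ev by eventually_elim (use eq \<kappa> H2(2) in auto)
      ultimately have "((\<lambda>z. F z / z) \<longlongrightarrow> c1 / (\<kappa> * c2)) (at 0)"
        by (rule Lim_transform_eventually)
      then show thesis
        using \<kappa> H1_asymp(2) H2_asymp(2) by (intro that) simp_all
    next
      case False
      \<comment> \<open>\<open>H2\<close> is continuous and nonzero on \<open>\<Omega>\<close>,
        while \<open>H2 (F z)\<close> tends to 0. Hence \<open>F\<close>, with values in
        \<open>\<Omega>\<close>, never attains \<open>l\<close>, as the open mapping argument
        requires.\<close>
      have l: "l \<notin> \<Omega>"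
      proof
        assume "l \<in> \<Omega>"
        then have "((\<lambda>z. H2 (F z)) \<longlongrightarrow> H2 l) (at 0)"
        proof (rule continuous_on_tendsto_compose[OF H2(1) fin])
          show "\<forall>\<^sub>F z in at 0. F z \<in> \<Omega>" using ev by eventually_elim (rule F_\<Omega>)
        qed
        from tendsto_unique[OF _ this lim] show False using H2(2)[of l] by simp
      qed
      define K where "K z = (if z = 0 then l else F z)" for z
      have K: "K holomorphic_on ball 0 r"
        unfolding K_def using F fin by (intro removable_singularity) auto
      have image: "\<exists>e>0. ball l e - {l} \<subseteq> F ` (ball 0 \<rho> - {0})" if \<rho>: "\<rho> > 0" "\<rho> \<le> r" for \<rho>
      proof -
        have "K holomorphic_on ball 0 \<rho>" using \<rho> by (intro holomorphic_on_subset[OF K]) auto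
        moreover have "K w \<noteq> K 0" if "w \<in> ball 0 \<rho> - {0}" for w
        proof -
          have "F w \<in> \<Omega>" using that \<rho> by (intro F_\<Omega>) auto
          then show ?thesis using that l by (auto simp: K_def)
        qed
        ultimately obtain e where e: "e > 0" "ball (K 0) e \<subseteq> K ` ball 0 \<rho>"
          using open_image_punctured_nhd[OF \<rho>(1)] by metis
        have "ball l e - {l} \<subseteq> F ` (ball 0 \<rho> - {0})"
        proof
          fix y assume y: "y \<in> ball l e - {l}"
          then have "y \<in> ball (K 0) e" by (simp add: K_def)
          then obtain z where z: "z \<in> ball 0 \<rho>" "y = K z" using e(2) by blast
          then have "z \<noteq> 0" using y by (auto simp: K_def)
          then show "y \<in> F ` (ball 0 \<rho> - {0})" using z by (simp add: K_def)
        qed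
        then show ?thesis using e(1) by blast
      qed
      obtain e where e: "e > 0" "ball l e - {l} \<subseteq> F ` (ball 0 r - {0})"
        using image[OF r order_refl] by blast
      then have "ball l e - {l} \<subseteq> \<Omega>" using F_\<Omega> by blast
      moreover have "(H2 \<longlongrightarrow> 0) (at l)"
        unfolding tendsto_iff
      proof (intro allI impI)
        fix \<epsilon> :: real assume "\<epsilon> > 0"
        obtain \<rho> where \<rho>: "\<rho> > 0" "\<rho> \<le> r" "\<forall>z\<in>ball 0 \<rho> - {0}. cmod (H2 (F z)) < \<epsilon>"
          using small[OF \<open>\<epsilon> > 0\<close>] by blast
        obtain e where "e > 0" and e: "ball l e - {l} \<subseteq> F ` (ball 0 \<rho> - {0})"
          using image[OF \<rho>(1,2)] by blast
        show "\<forall>\<^sub>F y in at l. dist (H2 y) 0 < \<epsilon>"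
          unfolding eventually_at
        proof (intro exI conjI ballI impI)
          fix y assume "y \<noteq> l \<and> dist y l < e"
          then have "y \<in> ball l e - {l}" by (auto simp: dist_commute)
          then show "dist (H2 y) 0 < \<epsilon>" using e \<rho>(3) by auto
        qed (rule \<open>e > 0\<close>)
      qed
      ultimately show thesis using puncture[OF False e(1)] by simp
    qed
  qed
qed

section \<open>From the end coordinate back to the cylinder\<close>

context end_sign
begin

lemma end_coord_image: "end_coord s ` D = end_exp s ` (to_cylinder -` D)"
proof (intro set_eqI iffI)
  fix z assume "z \<in> end_coord s ` D"
  then obtain x where x: "x \<in> D" "z = end_coord s x" by auto
  moreover obtain w where "x = to_cylinder w" using ex_to_cylinder by blast
  ultimately show "z \<in> end_exp s ` (to_cylinder -` D)"
    by (auto simp: end_coord_to_cylinder)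
next
  fix z assume "z \<in> end_exp s ` (to_cylinder -` D)"
  then obtain w where "to_cylinder w \<in> D" "z = end_coord s (to_cylinder w)"
    by (auto simp: end_coord_to_cylinder)
  then show "z \<in> end_coord s ` D" by blast
qed

lemma to_cylinder_end_log: "to_cylinder (end_log s (end_coord s x)) = x"
proof -
  obtain w where w: "x = to_cylinder w" using ex_to_cylinder by blast
  obtain n where "end_log s (end_exp s w) = w + of_int n"
    using end_log_end_exp[OF s] by blast
  then show ?thesis
    unfolding w end_coord_to_cylinder by (simp add: to_cylinder_eq_iff)
qed

lemma to_cylinder_shift: "to_cylinder (w + of_int n) = to_cylinder w"
  by (simp add: to_cylinder_eq_iff)

lemma holomorphic_on_end_coord:
  assumes "cylinder_holomorphic_on \<psi> D"
  shows "(\<lambda>z. end_coord s (\<psi> (to_cylinder (end_log s z)))) holomorphic_on end_coord s ` D"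
  unfolding end_coord_image
proof (rule holomorphic_on_end_log[where k = "\<lambda>w. end_coord s (\<psi> (to_cylinder w))"])
  show "(\<lambda>w. end_coord s (\<psi> (to_cylinder w))) holomorphic_on to_cylinder -` D"
    unfolding holomorphic_on_def
  proof
    fix w assume w: "w \<in> to_cylinder -` D"
    then have "to_cylinder w \<in> D" by simp
    with assms obtain W G where W: "open W" "w \<in> W" "G holomorphic_on W"
      "\<forall>v\<in>W. to_cylinder v \<in> D \<longrightarrow> \<psi> (to_cylinder v) = to_cylinder (G v)"
      unfolding cylinder_holomorphic_on_def by meson
    have "(\<lambda>v. end_exp s (G v)) holomorphic_on W \<inter> to_cylinder -` D"
      by (intro holomorphic_intros holomorphic_on_subset[OF W(3)]) auto
    then have "(\<lambda>w. end_coord s (\<psi> (to_cylinder w))) holomorphic_on W \<inter> to_cylinder -` D"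
      by (rule holomorphic_transform) (simp add: W(4) end_coord_to_cylinder)
    then have "(\<lambda>w. end_coord s (\<psi> (to_cylinder w))) field_differentiable
        at w within (W \<inter> to_cylinder -` D)"
      using w W(2) by (simp add: holomorphic_on_def)
    moreover have "at w within (W \<inter> to_cylinder -` D) = at w within to_cylinder -` D"
      by (rule at_within_nhd[OF W(2,1)]) auto
    ultimately show "(\<lambda>w. end_coord s (\<psi> (to_cylinder w))) field_differentiable
        at w within to_cylinder -` D"
      by simp
  qed
qed (simp_all add: to_cylinder_shift)

lemma end_coord_diff: "end_coord s (x - y) = end_coord s x / end_coord s y"
proof -
  obtain v w where "x = to_cylinder v" "y = to_cylinder w" using ex_to_cylinder by metis
  moreover have "to_cylinder v - to_cylinder w = to_cylinder (v - w)"
    by transfer simp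
  ultimately show ?thesis
    by (simp add: end_coord_to_cylinder end_exp_def exp_diff right_diff_distrib)
qed

lemma end_coord_nz [simp]: "end_coord s x \<noteq> 0"
  using ex_to_cylinder[of x] by (auto simp: end_coord_to_cylinder)

lemma eventually_cylinder_endE:
  assumes "\<forall>\<^sub>F x in cylinder_end s. x \<in> D"
  obtains M where "\<And>w. M < of_int s * Im w \<Longrightarrow> to_cylinder w \<in> D"
    "ball 0 (exp (- 2 * pi * M)) - {0} \<subseteq> end_coord s ` D"
proof -
  obtain M where M: "\<And>w. M < of_int s * Im w \<Longrightarrow> to_cylinder w \<in> D"
    using assms unfolding eventually_cylinder_end by blast
  have "z \<in> end_coord s ` D" if "z \<in> ball 0 (exp (- 2 * pi * M)) - {0}" for z
  proof -
    have "to_cylinder (end_log s z) \<in> D"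
      using that s_nz by (intro M end_log_far) auto
    moreover have "end_coord s (to_cylinder (end_log s z)) = z"
      using that s_nz by (simp add: end_coord_to_cylinder end_exp_end_log)
    ultimately show ?thesis by (metis imageI)
  qed
  then show thesis using that M by blast
qed

text \<open>\<open>F z / z\<close> is the end coordinate of \<open>\<psi> x - x\<close>. Its limit
  \<open>c\<close> yields the translation through \<open>end_log s c\<close>, and it also makes
  \<open>F\<close> tend to 0, so the singularity is removable.\<close>

lemma asymp_imp_extends_and_translation:
  assumes \<psi>: "cylinder_holomorphic_on \<psi> D" and end_D: "\<forall>\<^sub>F x in cylinder_end s. x \<in> D"
    and c: "c \<noteq> 0" "((\<lambda>z. end_coord s (\<psi> (to_cylinder (end_log s z))) / z) \<longlongrightarrow> c) (at 0)"
  shows "extends_fixing_end s \<psi> D"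
    and "\<exists>\<rho> r. r \<in> o[cylinder_end s](\<lambda>_. 1 :: complex) \<and>
       (\<forall>\<^sub>F x in cylinder_end s. \<psi> x = x + to_cylinder \<rho> + to_cylinder (r x))"
proof -
  define F where "F z = end_coord s (\<psi> (to_cylinder (end_log s z)))" for z
  have F_coord: "F (end_coord s x) = end_coord s (\<psi> x)" for x
    by (simp add: F_def to_cylinder_end_log)
  have F_hol: "F holomorphic_on end_coord s ` D"
    unfolding F_def by (rule holomorphic_on_end_coord[OF \<psi>])
  have F_lim: "((\<lambda>z. F z / z) \<longlongrightarrow> c) (at 0)" using c by (simp add: F_def)
  have "((\<lambda>z. z * (F z / z)) \<longlongrightarrow> 0 * c) (at 0)" by (intro tendsto_intros F_lim)
  then have "((\<lambda>z. z * (F z / z)) \<longlongrightarrow> 0) (at 0)" by simp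
  then have lim0: "(F \<longlongrightarrow> 0) (at 0)"
    by (rule Lim_transform_eventually) (auto simp: eventually_at_filter)
  obtain M where M: "ball 0 (exp (- 2 * pi * M)) - {0} \<subseteq> end_coord s ` D"
    using eventually_cylinder_endE[OF end_D] by blast
  define F0 where "F0 z = (if z = 0 then 0 else F z)" for z
  have at0: "F0 holomorphic_on ball 0 (exp (- 2 * pi * M))"
    unfolding F0_def using lim0
    by (intro removable_singularity holomorphic_on_subset[OF F_hol M]) auto
  have "F0 holomorphic_on insert 0 (end_coord s ` D)"
    unfolding holomorphic_on_def
  proof
    fix z assume z: "z \<in> insert 0 (end_coord s ` D)"
    show "F0 field_differentiable at z within insert 0 (end_coord s ` D)"
    proof (cases "z = 0")
      case True
      have "F0 field_differentiable at 0"
        by (rule holomorphic_on_imp_differentiable_at[OF at0]) auto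
      then show ?thesis using True field_differentiable_at_within by blast
    next
      case False
      then have "z \<in> end_coord s ` D" using z by auto
      moreover have "F0 holomorphic_on end_coord s ` D"
        by (rule holomorphic_transform[OF F_hol]) (auto simp: F0_def)
      ultimately have "F0 field_differentiable at z within end_coord s ` D"
        unfolding holomorphic_on_def by blast
      moreover have "at z within end_coord s ` D = at z within insert 0 (end_coord s ` D)"
        using False by (intro at_within_nhd[of z "- {0}"]) auto
      ultimately show ?thesis by simp
    qed
  qed
  then show "extends_fixing_end s \<psi> D"
    unfolding extends_fixing_end_def
    by (intro exI[of _ F0]) (auto simp: F0_def F_coord)
  \<comment> \<open>Normalised to tend to 1, where the principal logarithm is continuous; the
    remainder \<open>r\<close> thus tends to \<open>Ln 1 = 0\<close>.\<close>
  define q where "q x = F (end_coord s x) / end_coord s x / c" for x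
  define r where "r x = end_log s (q x)" for x
  have "((\<lambda>x. F (end_coord s x) / end_coord s x / c) \<longlongrightarrow> c / c) (cylinder_end s)"
    using c(1) filterlim_compose[OF F_lim filterlim_end_coord] by (intro tendsto_divide) auto
  then have q: "(q \<longlongrightarrow> 1) (cylinder_end s)"
    using c(1) by (simp add: q_def[abs_def])
  have "((\<lambda>x. Ln (q x) / (2 * of_real pi * \<i> * of_int s)) \<longlongrightarrow>
      Ln 1 / (2 * of_real pi * \<i> * of_int s)) (cylinder_end s)"
    using s_nz by (intro tendsto_intros q) auto
  then have "(r \<longlongrightarrow> 0) (cylinder_end s)"
    by (simp add: r_def[abs_def] end_log_def)
  then have r: "r \<in> o[cylinder_end s](\<lambda>_. 1)"
    by (intro smalloI_tendsto) auto
  have "\<psi> x = x + to_cylinder (end_log s c) + to_cylinder (r x)" for x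
  proof (rule inj_end_coord[OF s])
    obtain w where w: "x = to_cylinder w" using ex_to_cylinder by blast
    have "q x \<noteq> 0" using c(1) by (simp add: q_def F_coord)
    then have "end_coord s (x + to_cylinder (end_log s c) + to_cylinder (r x)) = end_coord s x * c * q x"
      using c(1) s_nz unfolding w to_cylinder_add[symmetric] end_coord_to_cylinder end_exp_add
      by (simp add: r_def w end_exp_end_log)
    also have "\<dots> = end_coord s (\<psi> x)"
      using c(1) by (simp add: q_def F_coord)
    finally show "end_coord s (\<psi> x) = end_coord s (x + to_cylinder (end_log s c) + to_cylinder (r x))"
      by simp
  qed
  with r show "\<exists>\<rho> r. r \<in> o[cylinder_end s](\<lambda>_. 1 :: complex) \<and>
       (\<forall>\<^sub>F x in cylinder_end s. \<psi> x = x + to_cylinder \<rho> + to_cylinder (r x))"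
    by (intro exI[of _ "end_log s c"] exI[of _ r]) simp
qed

end

section \<open>Application to the two horn maps\<close>

lemma horn_end_exists:
  assumes "parabolic_map U f a" "attracting_petal_coordinate U f PA \<Phi>A"
    "repelling_petal_coordinate U f PR \<Phi>R" "s = 1 \<or> s = - 1"
  obtains V g where "horn_end U f a PA \<Phi>A PR \<Phi>R V g s"
proof -
  obtain V g where "local_inverse U f V g" "attracting_petal_coordinate V g PR (\<lambda>z. - \<Phi>R z)"
    using assms(3) by (auto simp: repelling_petal_coordinate_def)
  with assms show thesis
    by (intro that horn_end.intro horn_data.intro end_sign.intro)
qed

context horn_end
begin

lemma H_asymp_of_end_component:
  assumes "end_component s (horn_dom U f PR \<Phi>R) D"
  obtains c where "c \<noteq> 0" "((\<lambda>z. H z / z) \<longlongrightarrow> c) (at 0)"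
proof -
  have D: "D \<subseteq> horn_dom U f PR \<Phi>R" and "\<forall>\<^sub>F x in cylinder_end s. x \<in> D"
    using assms by (auto simp: end_component_def dest: in_components_subset)
  then obtain M where M: "\<And>w. M < of_int s * Im w \<Longrightarrow> to_cylinder w \<in> D"
    using eventually_cylinder_endE by blast
  have "w \<in> LD" if "M < of_int s * Im w" for w
  proof -
    have "end_exp s w \<in> \<Omega>"
      using M[OF that] D end_coord_horn(1)[of "to_cylinder w"] by (auto simp: end_coord_to_cylinder)
    then show ?thesis by (simp add: end_exp_\<Omega>_iff)
  qed
  then show thesis using H_asymp that by blast
qed

end

theorem lemma1p5:
  fixes f1 f2 \<Phi>A1 \<Phi>A2 \<Phi>R1 \<Phi>R2 :: "complex \<Rightarrow> complex"
    and U1 U2 PA1 PA2 PR1 PR2 :: "complex set"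
    and a1 a2 :: complex
    and D1 D2 :: "cylinder set"
    and \<sigma> :: cylinder
    and s :: int
    and \<psi> :: "cylinder \<Rightarrow> cylinder"
  assumes "parabolic_map U1 f1 a1"
    and "parabolic_map U2 f2 a2"
    and "attracting_petal_coordinate U1 f1 PA1 \<Phi>A1"
    and "attracting_petal_coordinate U2 f2 PA2 \<Phi>A2"
    and "repelling_petal_coordinate U1 f1 PR1 \<Phi>R1"
    and "repelling_petal_coordinate U2 f2 PR2 \<Phi>R2"
    and "s = 1 \<or> s = -1"
    and "end_component s (horn_dom U1 f1 PR1 \<Phi>R1) D1"
    and "end_component s (horn_dom U2 f2 PR2 \<Phi>R2) D2"
    and "\<psi> ` D1 \<subseteq> D2"
    and "cylinder_holomorphic_on \<psi> D1"
    and "\<forall>x\<in>D1. horn U1 f1 PA1 \<Phi>A1 PR1 \<Phi>R1 x = horn U2 f2 PA2 \<Phi>A2 PR2 \<Phi>R2 (\<psi> x) - \<sigma>"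
  shows "extends_fixing_end s \<psi> D1 \<and>
    (\<exists>\<rho>::complex. \<exists>r::cylinder \<Rightarrow> complex.
       r \<in> o[cylinder_end s](\<lambda>_. 1) \<and>
       (\<forall>\<^sub>F x in cylinder_end s. \<psi> x = x + to_cylinder \<rho> + to_cylinder (r x)))"
proof -
  obtain V1 g1 where "horn_end U1 f1 a1 PA1 \<Phi>A1 PR1 \<Phi>R1 V1 g1 s"
    using horn_end_exists[OF assms(1,3,5,7)] by blast
  then interpret E1: horn_end U1 f1 a1 PA1 \<Phi>A1 PR1 \<Phi>R1 V1 g1 s .
  obtain V2 g2 where "horn_end U2 f2 a2 PA2 \<Phi>A2 PR2 \<Phi>R2 V2 g2 s"
    using horn_end_exists[OF assms(2,4,6,7)] by blast
  then interpret E2: horn_end U2 f2 a2 PA2 \<Phi>A2 PR2 \<Phi>R2 V2 g2 s .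
  have D1: "D1 \<subseteq> horn_dom U1 f1 PR1 \<Phi>R1" "\<forall>\<^sub>F x in cylinder_end s. x \<in> D1"
    and D2: "D2 \<subseteq> horn_dom U2 f2 PR2 \<Phi>R2"
    using assms(8,9) by (auto simp: end_component_def dest: in_components_subset)
  obtain c1 where c1: "c1 \<noteq> 0" "((\<lambda>z. E1.H z / z) \<longlongrightarrow> c1) (at 0)"
    using E1.H_asymp_of_end_component[OF assms(8)] by blast
  obtain c2 where c2: "c2 \<noteq> 0" "((\<lambda>z. E2.H z / z) \<longlongrightarrow> c2) (at 0)"
    using E2.H_asymp_of_end_component[OF assms(9)] by blast
  obtain M where M: "ball 0 (exp (- 2 * pi * M)) - {0} \<subseteq> end_coord s ` D1"
    using E1.eventually_cylinder_endE[OF D1(2)] by blast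
  define F where "F z = end_coord s (\<psi> (to_cylinder (end_log s z)))" for z
  have F_coord: "F (end_coord s x) = end_coord s (\<psi> x)" for x
    by (simp add: F_def E1.to_cylinder_end_log)
  \<comment> \<open>Translation by \<open>- \<sigma>\<close> on the cylinder is division by
    \<open>end_coord s \<sigma>\<close> in the chart, which supplies the constant \<kappa>.\<close>
  have F_in: "F z \<in> E2.\<Omega>" and eq: "E1.H z = inverse (end_coord s \<sigma>) * E2.H (F z)"
    if z: "z \<in> ball 0 (exp (- 2 * pi * M)) - {0}" for z
  proof -
    obtain x where x: "x \<in> D1" "z = end_coord s x" using z M by blast
    then have \<psi>x: "\<psi> x \<in> horn_dom U2 f2 PR2 \<Phi>R2" using assms(10) D2 by blast
    then show "F z \<in> E2.\<Omega>"
      using E2.end_coord_horn(1) by (simp add: x F_coord)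
    have "E1.H z = end_coord s (horn U1 f1 PA1 \<Phi>A1 PR1 \<Phi>R1 x)"
      using E1.end_coord_horn(2) x D1 by auto
    also have "\<dots> = end_coord s (horn U2 f2 PA2 \<Phi>A2 PR2 \<Phi>R2 (\<psi> x)) / end_coord s \<sigma>"
      using assms(12) x(1) by (simp add: E1.end_coord_diff)
    also have "\<dots> = inverse (end_coord s \<sigma>) * E2.H (F z)"
      using E2.end_coord_horn(2)[OF \<psi>x] by (simp add: x F_coord field_simps)
    finally show "E1.H z = inverse (end_coord s \<sigma>) * E2.H (F z)" .
  qed
  have F_hol: "F holomorphic_on end_coord s ` D1"
    unfolding F_def by (rule E1.holomorphic_on_end_coord[OF assms(11)])
  have "of_real (exp (- 2 * pi * M) / 2) \<in> ball (0::complex) (exp (- 2 * pi * M)) - {0}"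
    by simp
  then have nonempty: "E2.\<Omega> \<noteq> {}" using F_in by blast
  have zero: "0 \<notin> E2.\<Omega>" by (simp add: E2.\<Omega>_iff)
  have inv_nz: "inverse (end_coord s \<sigma>) \<noteq> 0" by simp
  obtain c where c: "c \<noteq> 0" "((\<lambda>z. F z / z) \<longlongrightarrow> c) (at 0)"
    by (rule semiconjugacy_asymp[OF exp_gt_zero holomorphic_on_subset[OF F_hol M] F_in
          holomorphic_on_imp_continuous_on[OF E2.H_hol] E2.H_nz zero nonempty eq inv_nz
          c1(2,1) c2(2,1) E2.H_not_tendsto_0_at_puncture E2.H_not_tendsto_0_at_infinity])
  show ?thesis
    using E1.asymp_imp_extends_and_translation[OF assms(11) D1(2) c(1) c(2)[unfolded F_def]] by blast
qed

end
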